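(* Let $$L=\Bigl\{s\in\mathbb{C}:\ |s|>2\pi e^2,\ -\tfrac{\pi}{2}+2\varphi\bigl(\sqrt{|s|/2\pi}\bigr)<\arg s<\tfrac{\pi}{2}\Bigr\},$$ where $\varphi$ is the function defined in the context, and write $s=\sigma+it$. For $s\in L$ with $t>0$ we have $$\mathcal{R}(s)=\sum_{n=1}^{\ell}\frac{1}{n^s}+O\bigl(|s/2\pi e|^{-\frac{\sigma}{2}}\bigr).$$ For $s\in L$ with $t<0$ we have, for some constant $c>0$, $$\mathcal{R}(s)=\sum_{n=1}^{\ell}\frac{1}{n^s}+O\bigl(e^{-c\frac{\sqrt{|s|}}{\log|s|}}\bigr).$$ The constant $c$ and the implied constants are absolute.
   Context: Riemann's auxiliary function is the entire function $$\mathcal{R}(s)=\int_{0\swarrow1}\frac{x^{-s}e^{\pi i x^2}}{e^{\pi i x}-e^{-\pi i x}}\,dx,$$ where the path is a straight line of direction $e^{-3\pi i/4}$ (running from the upper right to the lower left) crossing the real axis at a point strictly between $0$ and $1$, and $x^{-s}=\exp(-s\log x)$ with the principal logarithm. Throughout $\arg s$ is the principal argument. For $-\pi<\arg s<\pi$ put $\xi=\sqrt{s/(2\pi i)}$ with $-\frac{3\pi}{4}<\arg\xi<\frac{\pi}{4}$, $\xi_1=\operatorname{Re}\xi$, $\xi_2=\operatorname{Im}\xi$, and $\ell=\lfloor\xi_1-\xi_2\rfloor$. The function $\varphi:[e,+\infty)\to[0,\pi/4]$ is the (unique) function such that $$\{\xi\in\mathbb{C}:|\xi|\ge e,\ |\xi^{-2\pi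 i\xi^2}e^{\pi i\xi^2+\pi\xi}|\le1,\ -\tfrac{\pi}{2}\le\arg\xi\le-\tfrac{\pi}{4}\}=\{\xi\in\mathbb{C}:|\xi|\ge e,\ -\tfrac{\pi}{2}+\varphi(|\xi|)\le\arg\xi\le-\tfrac{\pi}{4}\},$$ where $\xi^z=\exp(z\log\xi)$ with $\log\xi=\log|\xi|+i\arg\xi$, $-\pi/2\le\arg\xi\le0$. *)

theory Defs
  imports "HOL-Complex_Analysis.Complex_Analysis"
begin

text \<open>
  Riemann's auxiliary function, as the integral along the line
  \<open>x = a + u * exp (- 3 * pi * \<i> / 4)\<close>, \<open>u\<close> running from \<open>-\<infinity>\<close> to \<open>\<infinity>\<close>, which crosses
  the real axis at \<open>a\<close>.  For \<open>0 < a < 1\<close> the value does not depend on \<open>a\<close>.  The line avoids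
  \<open>0\<close> and the negative real axis, so \<open>powr\<close> is \<open>exp (- s * Ln x)\<close> there.
\<close>

definition RAux_integrand :: "complex \<Rightarrow> complex \<Rightarrow> complex" where
  "RAux_integrand s x =
     x powr (- s) * exp (pi * \<i> * x\<^sup>2) / (exp (pi * \<i> * x) - exp (- (pi * \<i> * x)))"

definition RAux :: "real \<Rightarrow> complex \<Rightarrow> complex" where
  "RAux a s =
     (LINT u|lborel. RAux_integrand s (of_real a + of_real u * cis (- (3 * pi / 4)))
                       * cis (- (3 * pi / 4)))"

definition xi :: "complex \<Rightarrow> complex" where
  "xi s = (THE w. w\<^sup>2 = s / (2 * pi * \<i>) \<and> - (3 * pi / 4) < Arg w \<and> Arg w < pi / 4)"

definition ell :: "complex \<Rightarrow> int" where
  "ell s = \<lfloor>Re (xi s) - Im (xi s)\<rfloor>"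

text \<open>
  The extensional function space makes the function unique as a total function:
  outside \<open>{exp 1..}\<close> it is \<open>undefined\<close>.
\<close>

definition phi :: "real \<Rightarrow> real" where
  "phi = (THE f. f \<in> {exp 1..} \<rightarrow>\<^sub>E {0..pi / 4} \<and>
     {w :: complex. cmod w \<ge> exp 1 \<and>
        cmod (w powr (- (2 * pi * \<i> * w\<^sup>2)) * exp (pi * \<i> * w\<^sup>2 + pi * w)) \<le> 1 \<and>
        - (pi / 2) \<le> Arg w \<and> Arg w \<le> - (pi / 4)}
     = {w. cmod w \<ge> exp 1 \<and> - (pi / 2) + f (cmod w) \<le> Arg w \<and> Arg w \<le> - (pi / 4)})"

definition L :: "complex set" where
  "L = {s. cmod s > 2 * pi * (exp 1)\<^sup>2 \<and>
           - (pi / 2) + 2 * phi (sqrt (cmod s / (2 * pi))) < Arg s \<and> Arg s < pi / 2}"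

end

theory Submission
  imports Defs "HOL-Probability.Distributions" "HOL-Real_Asymp.Real_Asymp"
begin

text \<open>
  In the coordinate \<open>y = e\<^sup>i\<^sup>\<pi>\<^sup>/\<^sup>4 x\<close> the path is a vertical line, \<open>e\<^sup>\<pi>\<^sup>i\<^sup>x\<^sup>2\<close> becomes \<open>exp (\<pi> y\<^sup>2)\<close>, and the
  saddle point \<open>\<xi>\<close> becomes the square root \<open>\<eta>\<close> of \<open>s / 2\<pi>\<close> with \<open>Re \<eta> > 0\<close>.  Moving the line to the
  one crossing the original real axis at \<open>\<ell> + 1/2\<close> picks up the residues \<open>n\<^sup>-\<^sup>s\<close>, \<open>n \<le> \<ell>\<close>.  This line
  passes within distance \<open>1/2\<close> of \<open>\<eta>\<close>, and the kernel \<open>1 / sin\<close> is bounded on it.  The exponent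
  \<open>h(y) = - s log x + \<pi> y\<^sup>2\<close> satisfies \<open>h'(y) = 2\<pi> (y - \<eta>) (1 + \<eta>/y)\<close>, and \<open>Re (1 + \<eta>/y) \<ge> 1/2\<close> near
  the line because \<open>\<bar>arg \<eta>\<bar> \<le> \<pi>/4\<close>; hence \<open>Re h\<close> is bounded by \<open>Re h(\<eta>) + O(1)\<close> minus a multiple of
  \<open>(Im (y - \<eta>))\<^sup>2\<close>, and the remaining integral is \<open>O(\<bar>exp (h(\<eta>))\<bar>)\<close>.

  Here \<open>Re h(\<eta>) = - \<sigma>/2 log \<bar>s/2\<pi>e\<bar> + t/2 (arg s - \<pi>/2)\<close>, which settles \<open>t > 0\<close>.  For \<open>t < 0\<close> the
  definition of \<open>\<phi>\<close> says precisely that \<open>Re h(\<eta>) \<le> - \<pi> Re \<xi>\<close>, and it forces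
  \<open>Re \<xi> \<ge> \<bar>\<xi>\<bar> / (6 log \<bar>\<xi>\<bar>)\<close>.
\<close>

subsection \<open>The rotated integrand\<close>

text \<open>The exponent of x^(-s) e^(pi i x^2) at x = \<open>cis (- (pi / 4)) * y\<close>. Writing
  log x as \<open>Ln y\<close> minus a constant makes it visibly holomorphic on Re y > 0.\<close>

definition rot_phase :: "complex \<Rightarrow> complex \<Rightarrow> complex" where
  "rot_phase s y = - s * (Ln y - \<i> * of_real (pi / 4)) + of_real pi * y\<^sup>2"

text \<open>The leading \<open>cis (- (pi / 4))\<close> is dx/dy, and e^(pi i x) - e^(-pi i x) = 2 i
  sin(pi x).\<close>

definition rot_integrand :: "complex \<Rightarrow> complex \<Rightarrow> complex" where
  "rot_integrand s y = cis (- (pi / 4)) * exp (rot_phase s y)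
     / (2 * \<i> * sin (of_real pi * (cis (- (pi / 4)) * y)))"

lemma cis_3pi4: "cis (- (3 * pi / 4)) = - cis (pi / 4)"
proof -
  have "cis (- (3 * pi / 4)) = cis (pi / 4 + - pi)"
    by (rule arg_cong[where f = cis]) simp
  also have "\<dots> = - cis (pi / 4)"
    unfolding cis_mult[symmetric] by (simp add: complex_eq_iff)
  finally show ?thesis .
qed

text \<open>The argument of y stays within pi/2 of 0, so turning by -pi/4 does not cross the branch
  cut.\<close>

lemma Ln_cis_mult_Re_pos:
  assumes "Re y > 0"
  shows "Ln (cis (- (pi / 4)) * y) = Ln y - \<i> * of_real (pi / 4)"
proof -
  have *: "Ln (cis (- (pi / 4))) = - (\<i> * of_real (pi / 4))"
  proof (rule Ln_unique)
    show "Im (- (\<i> * of_real (pi / 4))) \<le> pi" using pi_gt_zero by (simp del: pi_gt_zero)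
  qed (auto simp: cis_conv_exp)
  have "\<bar>Im (Ln y)\<bar> < pi / 2"
    using assms Re_Ln_pos_lt_imp by blast
  hence "Ln (cis (- (pi / 4)) * y) = Ln (cis (- (pi / 4))) + Ln y"
    using assms by (intro Ln_times_simple) (auto simp: *)
  thus ?thesis by (simp add: *)
qed

lemma RAux_integrand_rot:
  assumes "Re y > 0"
  shows "cis (- (pi / 4)) * RAux_integrand s (cis (- (pi / 4)) * y) = rot_integrand s y"
proof -
  have "y \<noteq> 0" using assms by auto
  have "\<i> * (cis (- (pi / 4)))\<^sup>2 = \<i> * cis (- (pi / 2))"
    by (simp add: power2_eq_square cis_mult)
  hence sq: "\<i> * (cis (- (pi / 4)))\<^sup>2 = 1" by simp
  have "pi * \<i> * (cis (- (pi / 4)) * y)\<^sup>2 = pi * (\<i> * (cis (- (pi / 4)))\<^sup>2) * y\<^sup>2"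
    by (simp only: power_mult_distrib mult_ac)
  hence 1: "pi * \<i> * (cis (- (pi / 4)) * y)\<^sup>2 = pi * y\<^sup>2"
    by (simp only: sq mult_1_right)
  have 2: "exp (pi * \<i> * x) - exp (- (pi * \<i> * x)) = 2 * \<i> * sin (pi * x)" for x :: complex
    by (simp add: sin_exp_eq mult_ac)
  show ?thesis
    unfolding RAux_integrand_def rot_integrand_def rot_phase_def 1 2
    using \<open>y \<noteq> 0\<close> by (simp add: powr_def Ln_cis_mult_Re_pos[OF assms] exp_add[symmetric])
qed

text \<open>Turning by pi/4 sends a + u e^(-3 pi i/4) to a/sqrt 2 + i (a/sqrt 2 - u). The vertical
  line is run downwards, whence the factor -i when v increases.\<close>

lemma RAux_eq_rot:
  assumes "a > 0"
  shows "RAux a s = - \<i> * (LINT v|lborel. rot_integrand s (Complex (a / sqrt 2) v))"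
proof -
  define g where "g = (\<lambda>v. - rot_integrand s (Complex (a / sqrt 2) v) * \<i>)"
  have "RAux_integrand s (of_real a + of_real u * cis (- (3 * pi / 4))) * cis (- (3 * pi / 4))
      = g (a / sqrt 2 + (-1) * u)" for u
  proof -
    let ?y = "Complex (a / sqrt 2) (a / sqrt 2 + (-1) * u)"
    have x: "of_real a + of_real u * cis (- (3 * pi / 4)) = cis (- (pi / 4)) * ?y"
      unfolding cis_3pi4 by (simp add: complex_eq_iff cos_45 sin_45 field_simps)
    have "R * cis (- (3 * pi / 4)) = - (cis (- (pi / 4)) * R) * \<i>" for R
      unfolding cis_3pi4 by (simp add: complex_eq_iff cos_45 sin_45 algebra_simps)
    moreover have "cis (- (pi / 4)) * RAux_integrand s (cis (- (pi / 4)) * ?y) = rot_integrand s ?y"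
      using assms by (intro RAux_integrand_rot) simp
    ultimately show ?thesis
      unfolding g_def x by simp
  qed
  hence "RAux a s = (LINT u|lborel. g (a / sqrt 2 + (-1) * u))"
    unfolding RAux_def by simp
  also have "\<dots> = (LINT v|lborel. g v)"
    using lborel_integral_real_affine[of "-1" g "a / sqrt 2"] by simp
  finally show ?thesis unfolding g_def by (simp add: mult.commute)
qed

section \<open>Lower bounds for the sine in the denominator\<close>

lemma cmod_sin_squared_ge: "(sin (Re w))\<^sup>2 + (Im w)\<^sup>2 \<le> (cmod (sin w))\<^sup>2"
proof -
  \<comment> \<open>|sin w|^2 = sin^2(Re w) + sinh^2(Im w), and |sinh t| \<ge> |t|.\<close>
  have "(Im w)\<^sup>2 \<le> ((exp (Im w) - inverse (exp (Im w))) / 2)\<^sup>2"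
    using real_le_abs_sinh[of "Im w"] by (simp only: abs_le_square_iff)
  moreover have "(cmod (sin w))\<^sup>2 = (cmod (cos (w - of_real (pi / 2))))\<^sup>2"
    by (simp add: cos_diff)
  moreover have "cos (Re w - pi / 2) = sin (Re w)"
    by (simp add: cos_diff)
  ultimately show ?thesis
    unfolding norm_cos_squared by (simp add: power_divide)
qed

lemma cmod_sin_ge_Im: "\<bar>Im w\<bar> \<le> cmod (sin w)"
proof (rule power2_le_imp_le)
  show "\<bar>Im w\<bar>\<^sup>2 \<le> (cmod (sin w))\<^sup>2"
    unfolding power2_abs
    using cmod_sin_squared_ge[of w] zero_le_power2[of "sin (Re w)"] by linarith
qed simp

text \<open>On the line through b the argument w of the sine has real part pi b + p and imaginary
  part p. Hence |sin(pi b)| is at most |sin(Re w)| + |p|, and each summand is at most |sin w|: where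
  p is small the real part controls the sine, elsewhere the imaginary part does.\<close>

lemma cmod_sin_diagonal_ge:
  "\<bar>sin (pi * b)\<bar> / 2 \<le> cmod (sin (of_real pi * (cis (- (pi / 4)) * Complex (b / sqrt 2) v)))"
proof -
  define p where "p = pi * (v / sqrt 2 - b / 2)"
  define w where "w = of_real pi * (cis (- (pi / 4)) * Complex (b / sqrt 2) v)"
  have w: "Re w = pi * b + p" "Im w = p"
    by (auto simp: w_def p_def cos_45 sin_45 field_simps)
  have "sin (pi * b) = sin (Re w) * cos p - cos (Re w) * sin p"
    unfolding w sin_diff[symmetric] by simp
  hence "\<bar>sin (pi * b)\<bar> \<le> \<bar>sin (Re w) * cos p\<bar> + \<bar>cos (Re w) * sin p\<bar>" by simp
  also have "\<dots> \<le> \<bar>sin (Re w)\<bar> * 1 + 1 * \<bar>p\<bar>"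
    unfolding abs_mult by (intro add_mono mult_mono) (auto simp: abs_sin_x_le_abs_x)
  also have "\<dots> \<le> cmod (sin w) + cmod (sin w)"
  proof (intro add_mono)
    have "\<bar>sin (Re w)\<bar>\<^sup>2 \<le> (cmod (sin w))\<^sup>2"
      unfolding power2_abs
      using cmod_sin_squared_ge[of w] zero_le_power2[of "Im w"] by linarith
    hence "\<bar>sin (Re w)\<bar> \<le> cmod (sin w)" by (rule power2_le_imp_le) simp
    thus "\<bar>sin (Re w)\<bar> * 1 \<le> cmod (sin w)" by simp
    show "1 * \<bar>p\<bar> \<le> cmod (sin w)"
      using cmod_sin_ge_Im[of w] w by simp
  qed
  finally show ?thesis unfolding w_def by simp
qed

lemma sin_pi_noninteger:
  assumes "b \<notin> \<int>"
  shows "sin (pi * b) \<noteq> 0"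
  using assms sin_zero_iff_int2[of "pi * b"] by auto

lemma cmod_rot_integrand:
  "cmod (rot_integrand s y) = exp (Re (rot_phase s y))
     / (2 * cmod (sin (of_real pi * (cis (- (pi / 4)) * y))))"
  by (simp add: rot_integrand_def norm_mult norm_divide)

section \<open>Gaussian decay and absolute convergence\<close>

lemma Re_rot_phase_le:
  assumes "Re s \<ge> 0" "0 < d" "d \<le> Re y"
  shows "Re (rot_phase s y) \<le> \<bar>Re s * ln d\<bar> + \<bar>Im s\<bar> * pi + pi * ((Re y)\<^sup>2 - (Im y)\<^sup>2)"
proof -
  have y: "y \<noteq> 0" using assms by auto
  have "d \<le> cmod y" using assms complex_Re_le_cmod[of y] by linarith
  hence "ln d \<le> ln (cmod y)" using assms(2) by (intro ln_mono) auto
  hence 1: "Re s * ln d \<le> Re s * ln (cmod y)" using assms(1) by (intro mult_left_mono)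
  have "\<bar>Im (Ln y)\<bar> < pi / 2" using assms Re_Ln_pos_lt_imp[of y] by auto
  hence "\<bar>Im (Ln y) - pi / 4\<bar> \<le> pi" by linarith
  hence "\<bar>Im s * (Im (Ln y) - pi / 4)\<bar> \<le> \<bar>Im s\<bar> * pi"
    unfolding abs_mult by (intro mult_left_mono) auto
  moreover have "Re (rot_phase s y) = - (Re s * ln (cmod y)) + Im s * (Im (Ln y) - pi / 4)
      + pi * ((Re y)\<^sup>2 - (Im y)\<^sup>2)"
    by (simp add: rot_phase_def y power2_eq_square algebra_simps)
  ultimately show ?thesis using 1 by linarith
qed

text \<open>A crude bound for fixed s, enough for convergence and for the horizontal sides. Its
  constant depends on s; uniformity comes from the saddle point later.\<close>

lemma rot_integrand_gauss_bound:
  assumes "Re s \<ge> 0" "0 < d" "d \<le> Re y" "Re y \<le> e"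
    and m: "0 < m" "m \<le> cmod (sin (of_real pi * (cis (- (pi / 4)) * y)))"
  shows "cmod (rot_integrand s y)
    \<le> exp (\<bar>Re s * ln d\<bar> + \<bar>Im s\<bar> * pi + pi * e\<^sup>2) / (2 * m) * exp (- pi * (Im y)\<^sup>2)"
proof -
  have "(Re y)\<^sup>2 \<le> e\<^sup>2" using assms by (intro power_mono) auto
  hence "pi * (Re y)\<^sup>2 \<le> pi * e\<^sup>2"
    by (intro mult_left_mono) auto
  hence "exp (Re (rot_phase s y))
      \<le> exp ((\<bar>Re s * ln d\<bar> + \<bar>Im s\<bar> * pi + pi * e\<^sup>2) + - pi * (Im y)\<^sup>2)"
    using Re_rot_phase_le[OF assms(1-3)] unfolding right_diff_distrib exp_le_cancel_iff by linarith
  also have "\<dots> = exp (\<bar>Re s * ln d\<bar> + \<bar>Im s\<bar> * pi + pi * e\<^sup>2) * exp (- pi * (Im y)\<^sup>2)"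
    by (rule exp_add)
  finally have "cmod (rot_integrand s y)
      \<le> exp (\<bar>Re s * ln d\<bar> + \<bar>Im s\<bar> * pi + pi * e\<^sup>2) * exp (- pi * (Im y)\<^sup>2) / (2 * m)"
    unfolding cmod_rot_integrand using m by (intro frac_le) auto
  thus ?thesis by simp
qed

lemma holomorphic_rot_integrand:
  assumes "\<And>y. y \<in> A \<Longrightarrow> Re y > 0"
    and "\<And>y. y \<in> A \<Longrightarrow> sin (of_real pi * (cis (- (pi / 4)) * y)) \<noteq> 0"
  shows "rot_integrand s holomorphic_on A"
proof -
  have "y \<notin> \<real>\<^sub>\<le>\<^sub>0" if "y \<in> A" for y
    using assms(1)[OF that] by (auto simp: complex_nonpos_Reals_iff)
  thus ?thesis
    unfolding rot_integrand_def rot_phase_def using assms(2) by (intro holomorphic_intros) auto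
qed

lemma continuous_on_rot_integrand:
  assumes "\<And>y. y \<in> A \<Longrightarrow> Re y > 0"
    and "\<And>y. y \<in> A \<Longrightarrow> sin (of_real pi * (cis (- (pi / 4)) * y)) \<noteq> 0"
  shows "continuous_on A (rot_integrand s)"
  using holomorphic_rot_integrand[OF assms] by (rule holomorphic_on_imp_continuous_on)

lemma integrable_gauss:
  assumes "k > 0"
  shows "integrable lborel (\<lambda>v::real. exp (- k * (v - m)\<^sup>2))"
proof -
  \<comment> \<open>The deviation for which the exponent of the normal density is
    \<open>- k * (v - m)\<^sup>2\<close>.\<close>
  define \<sigma> where "\<sigma> = sqrt (1 / (2 * k))"
  have \<sigma>: "\<sigma> > 0" "\<sigma>\<^sup>2 = 1 / (2 * k)" using assms by (auto simp: \<sigma>_def)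
  have "integrable lborel (\<lambda>v. sqrt (2 * pi * \<sigma>\<^sup>2) * normal_density m \<sigma> v)"
    using \<sigma> by (intro integrable_mult_right integrable_normal_density)
  also have "(\<lambda>v. sqrt (2 * pi * \<sigma>\<^sup>2) * normal_density m \<sigma> v) = (\<lambda>v. exp (- k * (v - m)\<^sup>2))"
    using assms \<sigma> by (auto simp: normal_density_def fun_eq_iff)
  finally show ?thesis .
qed

lemma LINT_gauss_shift:
  "(LINT v|lborel. exp (- k * (v - m)\<^sup>2)) = (LINT v|lborel. exp (- k * v\<^sup>2))" for k m :: real
  using lborel_integral_real_affine[of 1 "\<lambda>v. exp (- k * (v - m)\<^sup>2)" m] by simp

context
  fixes b :: real and s :: complex
  assumes b: "0 < b" "b \<notin> \<int>" and s: "Re s \<ge> 0"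
begin

lemma sin_diagonal_nonzero:
  "sin (of_real pi * (cis (- (pi / 4)) * Complex (b / sqrt 2) v)) \<noteq> 0"
  using cmod_sin_diagonal_ge[of b v] sin_pi_noninteger[OF b(2)] by auto

lemma rot_integrand_line_bound:
  "cmod (rot_integrand s (Complex (b / sqrt 2) v))
     \<le> exp (\<bar>Re s * ln (b / sqrt 2)\<bar> + \<bar>Im s\<bar> * pi + pi * (b / sqrt 2)\<^sup>2) / \<bar>sin (pi * b)\<bar>
        * exp (- pi * v\<^sup>2)"
  using rot_integrand_gauss_bound[of s "b / sqrt 2" "Complex (b / sqrt 2) v" "b / sqrt 2"
      "\<bar>sin (pi * b)\<bar> / 2"] b s sin_pi_noninteger[OF b(2)] cmod_sin_diagonal_ge[of b v]
  by simp

lemma continuous_on_rot_line: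
  "continuous_on A (\<lambda>v. rot_integrand s (Complex (b / sqrt 2) v))"
proof -
  have "continuous_on ((\<lambda>v. Complex (b / sqrt 2) v) ` A) (rot_integrand s)"
    using b sin_diagonal_nonzero by (intro continuous_on_rot_integrand) auto
  moreover have "continuous_on A (\<lambda>v. Complex (b / sqrt 2) v)"
    unfolding Complex_eq by (intro continuous_intros)
  ultimately show ?thesis by (rule continuous_on_compose2) auto
qed

lemma measurable_rot_line:
  "(\<lambda>v. rot_integrand s (Complex (b / sqrt 2) v)) \<in> borel_measurable lborel"
  using continuous_on_rot_line by (simp add: borel_measurable_continuous_onI)

lemma integrable_rot_line: "integrable lborel (\<lambda>v. rot_integrand s (Complex (b / sqrt 2) v))"
proof (rule Bochner_Integration.integrable_bound)
  show "integrable lborel (\<lambda>v.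
     exp (\<bar>Re s * ln (b / sqrt 2)\<bar> + \<bar>Im s\<bar> * pi + pi * (b / sqrt 2)\<^sup>2) / \<bar>sin (pi * b)\<bar>
        * exp (- pi * v\<^sup>2))"
    using integrable_gauss[of pi 0] by (intro integrable_mult_right) auto
qed (use measurable_rot_line rot_integrand_line_bound in auto)

text \<open>Connects the Lebesgue integral over the whole line with the integrals over the vertical
  sides of a rectangle, by dominated convergence.\<close>

lemma tendsto_integral_rot_line:
  "((\<lambda>T. integral {-T..T} (\<lambda>v. rot_integrand s (Complex (b / sqrt 2) v)))
     \<longlongrightarrow> (LINT v|lborel. rot_integrand s (Complex (b / sqrt 2) v))) at_top"
proof -
  let ?f = "\<lambda>v. rot_integrand s (Complex (b / sqrt 2) v)"
  have "((\<lambda>T. LINT v|lborel. indicator {-T..T} v *\<^sub>R ?f v) \<longlongrightarrow> (LINT v|lborel. ?f v)) at_top"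
  proof (rule integral_dominated_convergence_at_top)
    show "?f \<in> borel_measurable lborel" by (rule measurable_rot_line)
    show "(\<lambda>v. indicator {-T..T} v *\<^sub>R ?f v) \<in> borel_measurable lborel" for T :: real
      using measurable_rot_line by measurable
    show "integrable lborel (\<lambda>v. norm (?f v))" using integrable_rot_line by simp
    show "AE v in lborel. ((\<lambda>T. indicator {-T..T} v *\<^sub>R ?f v) \<longlongrightarrow> ?f v) at_top"
    proof (intro AE_I2 tendsto_eventually)
      fix v :: real
      show "\<forall>\<^sub>F T in at_top. indicator {-T..T} v *\<^sub>R ?f v = ?f v"
        using eventually_ge_at_top[of "\<bar>v\<bar>"] by eventually_elim (auto simp: indicator_def)
    qed
    show "\<forall>\<^sub>F T in at_top. AE v in lborel. norm (indicator {-T..T} v *\<^sub>R ?f v) \<le> norm (?f v)"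
      by (intro always_eventually allI AE_I2) (auto simp: indicator_def)
  qed
  moreover have "(LINT v|lborel. indicator {-T..T} v *\<^sub>R ?f v) = integral {-T..T} ?f" for T :: real
    using set_borel_integral_eq_integral(2)[of "{-T..T}" ?f]
      borel_integrable_atLeastAtMost'[OF continuous_on_rot_line]
    by (simp add: set_lebesgue_integral_def)
  ultimately show ?thesis by simp
qed

end

subsection \<open>Moving the line of integration\<close>

lemma exp_pi_i_square: "exp (of_real pi * (\<i> * (of_nat n)\<^sup>2)) = (- 1) ^ n"
proof -
  have "exp (of_real pi * (\<i> * (of_nat n)\<^sup>2)) = exp (of_nat (n * n) * (\<i> * of_real pi))"
    by (simp add: power2_eq_square mult_ac)
  also have "\<dots> = (- 1) ^ (n * n)"
    unfolding exp_of_nat_mult by simp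
  \<comment> \<open>n^2 and n have the same parity.\<close>
  also have "\<dots> = (- 1) ^ n" by (simp add: minus_one_power_iff)
  finally show ?thesis .
qed

text \<open>The pole is simple. The sign (-1)^n of the numerator cancels cos(pi n) from the
  derivative of the sine, and dx/dy cancels the same factor from the chain rule.\<close>

lemma residue_rot_integrand:
  assumes "n > 0"
  shows "residue (rot_integrand s) (of_nat n * cis (pi / 4)) = 1 / of_nat n powr s / (2 * of_real pi * \<i>)"
proof -
  define S where "S = {y. Re y > 0}"
  define p where "p = of_nat n * cis (pi / 4)"
  define f where "f = (\<lambda>y. cis (- (pi / 4)) * exp (rot_phase s y))"
  define g where "g = (\<lambda>y. 2 * \<i> * sin (of_real pi * (cis (- (pi / 4)) * y)))"
  have S: "open S" "connected S"
    unfolding S_def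
    by (auto intro: open_halfspace_Re_gt convex_connected convex_halfspace_Re_gt)
  have p: "p \<in> S" using assms by (simp add: p_def S_def cos_45)
  have cp: "cis (- (pi / 4)) * p = of_nat n"
    by (simp add: p_def cis_mult flip: mult.assoc)
  have np: "y \<notin> \<real>\<^sub>\<le>\<^sub>0" if "y \<in> S" for y
    using that by (auto simp: S_def complex_nonpos_Reals_iff)
  have hf: "f holomorphic_on S"
    unfolding f_def rot_phase_def using np by (intro holomorphic_intros) auto
  have hg: "g holomorphic_on S"
    unfolding g_def by (intro holomorphic_intros)
  have cosn: "cos (of_real pi * of_nat n :: complex) = (- 1) ^ n"
    using cos_npi2[of n] by (metis cos_of_real of_real_minus of_real_1 of_real_mult of_real_of_nat_eq of_real_power)
  have dg: "(g has_field_derivative 2 * \<i> * (cos (of_real pi * (cis (- (pi / 4)) * p)) * (of_real pi * cis (- (pi / 4))))) (at p)"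
    unfolding g_def by (auto intro!: derivative_eq_intros)
  have gp: "g p = 0"
    unfolding g_def cp using sin_npi2[of n]
    by (metis mult_zero_right of_real_0 of_real_mult of_real_of_nat_eq sin_of_real)
  have "residue (\<lambda>w. f w / g w) p
      = f p / (2 * \<i> * (cos (of_real pi * (cis (- (pi / 4)) * p)) * (of_real pi * cis (- (pi / 4)))))"
    using S p hf hg dg gp
    by (intro residue_simple_pole_deriv[where s = S]) (auto simp: f_def cp cosn)
  also have "(\<lambda>w. f w / g w) = rot_integrand s"
    by (auto simp: f_def g_def rot_integrand_def)
  finally have res: "residue (rot_integrand s) p = f p / (2 * \<i> * (cos (of_real pi * (cis (- (pi / 4)) * p)) * (of_real pi * cis (- (pi / 4)))))" .
  have Lnp: "Ln p = Ln (of_nat n) + \<i> * of_real (pi / 4)"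
  proof -
    have *: "Ln (cis (pi / 4)) = \<i> * of_real (pi / 4)"
    proof (rule Ln_unique)
      have "pi / 4 \<le> pi" using pi_gt_zero by linarith
      thus "Im (\<i> * of_real (pi / 4)) \<le> pi" by simp
    qed (auto simp: cis_conv_exp)
    show ?thesis
      unfolding p_def using assms by (subst Ln_times_of_nat) (auto simp: *)
  qed
  have "exp (rot_phase s p) = 1 / of_nat n powr s * (- 1) ^ n"
  proof -
    have "(cis (pi / 4))\<^sup>2 = cis (pi / 4 + pi / 4)"
      by (simp only: power2_eq_square cis_mult)
    also have "\<dots> = \<i>" by simp
    finally have "p\<^sup>2 = \<i> * (of_nat n)\<^sup>2"
      by (simp add: p_def power_mult_distrib)
    hence "exp (rot_phase s p) = exp (- (s * Ln (of_nat n))) * exp (of_real pi * (\<i> * (of_nat n)\<^sup>2))"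
      by (simp add: rot_phase_def Lnp flip: exp_add)
    also have "\<dots> = 1 / of_nat n powr s * (- 1) ^ n"
      unfolding exp_pi_i_square using assms by (simp add: powr_def exp_minus field_simps)
    finally show ?thesis .
  qed
  hence "f p / (2 * \<i> * (cos (of_real pi * (cis (- (pi / 4)) * p)) * (of_real pi * cis (- (pi / 4)))))
      = 1 / of_nat n powr s / (2 * of_real pi * \<i>)"
    unfolding f_def cp cosn by (simp add: field_simps)
  with res show ?thesis
    unfolding p_def by simp
qed

section \<open>Rectangles around the poles, and the limit of infinite height\<close>

lemma rot_sin_eq_0_imp:
  assumes "sin (of_real pi * (cis (- (pi / 4)) * y)) = 0" "Re y > 0"
  obtains n :: nat where "y = of_nat n * cis (pi / 4)" "Re y = n / sqrt 2"
proof -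
  obtain m :: int where "of_real pi * (cis (- (pi / 4)) * y) = of_real (of_int m * pi)"
    using assms(1) by (auto simp: sin_eq_0)
  hence "cis (- (pi / 4)) * y = of_int m" by simp
  hence "cis (pi / 4) * (cis (- (pi / 4)) * y) = cis (pi / 4) * of_int m" by simp
  hence y: "y = of_int m * cis (pi / 4)" by (simp add: cis_mult flip: mult.assoc)
  hence "m > 0" using assms(2) by (simp add: cos_45 zero_less_mult_iff)
  then obtain n where "m = int n" using zero_less_imp_eq_int by auto
  thus ?thesis
    using that[of n] y by (simp add: cos_45 real_div_sqrt field_simps)
qed

text \<open>The residue theorem on a rectangle. The poles n e^(i pi/4) have height n/sqrt 2, so T >
  b/sqrt 2 keeps those with n < b below the top side.\<close>

lemma rot_contour_shift_finite:
  fixes s :: complex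
  assumes ab: "0 < a" "a < b" "a \<notin> \<int>" "b \<notin> \<int>" and T: "T > b / sqrt 2"
  defines "F \<equiv> rot_integrand s"
  shows "contour_integral (linepath (Complex (a / sqrt 2) (-T)) (Complex (b / sqrt 2) (-T))) F
       + \<i> * integral {-T..T} (\<lambda>v. F (Complex (b / sqrt 2) v))
       - contour_integral (linepath (Complex (a / sqrt 2) T) (Complex (b / sqrt 2) T)) F
       - \<i> * integral {-T..T} (\<lambda>v. F (Complex (a / sqrt 2) v))
       = (\<Sum>n | a < real n \<and> real n < b. 1 / of_nat n powr s)"
proof -
  define N where "N = {n::nat. a < real n \<and> real n < b}"
  \<comment> \<open>An open strip between integer lines. As a and b are not integers, it contains
    the closed rectangle, and its only poles are those with a < n < b.\<close>
  define S where "S = {y. of_int \<lfloor>a\<rfloor> / sqrt 2 < Re y} \<inter> {y. Re y < of_int \<lceil>b\<rceil> / sqrt 2}"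
  define pole where "pole = (\<lambda>n::nat. of_nat n * cis (pi / 4))"
  define A B where "A = Complex (a / sqrt 2) (-T)" and "B = Complex (b / sqrt 2) T"
  \<comment> \<open>The lower right and the upper left corner.\<close>
  define a2 a4 where "a2 = Complex (Re B) (Im A)" and "a4 = Complex (Re A) (Im B)"
  have T0: "T > 0" using T ab by (smt (verit) divide_pos_pos real_sqrt_gt_zero)
  have fl: "of_int \<lfloor>a\<rfloor> < a" "b < of_int \<lceil>b\<rceil>" "0 \<le> \<lfloor>a\<rfloor>"
    using ab by (smt (verit) Ints_of_int floor_correct, smt (verit) Ints_of_int ceiling_correct, simp)
  have finN: "finite N"
    by (rule finite_subset[of _ "{..nat \<lceil>b\<rceil>}"]) (auto simp: N_def, linarith)
  have inj: "inj_on pole N"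
    by (auto simp: inj_on_def pole_def cis_neq_zero)
  have S: "open S" "connected S"
    unfolding S_def
    by (auto intro!: open_Int open_halfspace_Re_gt open_halfspace_Re_lt
        convex_connected convex_Int convex_halfspace_Re_gt convex_halfspace_Re_lt)
  have Spos: "Re y > 0" if "y \<in> S" for y
  proof -
    have "0 \<le> of_int \<lfloor>a\<rfloor> / sqrt 2" using fl by simp
    thus ?thesis using that by (auto simp: S_def)
  qed
  have zero: "y \<in> pole ` N" if y: "y \<in> S" "sin (of_real pi * (cis (- (pi / 4)) * y)) = 0" for y
  proof -
    obtain n :: nat where n: "y = of_nat n * cis (pi / 4)" "Re y = n / sqrt 2"
      using rot_sin_eq_0_imp[OF y(2) Spos[OF y(1)]] by metis
    have "of_int \<lfloor>a\<rfloor> < real n" "real n < of_int \<lceil>b\<rceil>"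
      using y(1) n by (auto simp: S_def divide_less_cancel)
    hence "\<lfloor>a\<rfloor> < int n" "int n < \<lceil>b\<rceil>" by linarith+
    hence "a < real n" "real n < b" by (simp_all add: floor_less_iff less_ceiling_iff)
    thus ?thesis using n by (auto simp: N_def pole_def)
  qed
  have hol: "F holomorphic_on S - pole ` N"
    unfolding F_def using zero Spos by (intro holomorphic_rot_integrand) auto
  have ord: "Re A \<le> Re B" "Im A \<le> Im B" "Re A < Re B" "Im A < Im B"
    using ab T0 by (auto simp: A_def B_def divide_strict_right_mono divide_right_mono)
  have inbox: "pole ` N \<subseteq> box A B"
  proof
    fix y assume "y \<in> pole ` N"
    then obtain n where n: "a < real n" "real n < b" "y = pole n" by (auto simp: N_def)
    have y: "Re y = real n / sqrt 2" "Im y = real n / sqrt 2"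
      using n(3) by (auto simp: pole_def cos_45 sin_45 real_div_sqrt field_simps)
    have "a / sqrt 2 < real n / sqrt 2" "real n / sqrt 2 < b / sqrt 2" "0 \<le> real n / sqrt 2"
      using n by (auto simp: divide_strict_right_mono)
    moreover from this have "- T < real n / sqrt 2" "real n / sqrt 2 < T" using T T0 by linarith+
    ultimately show "y \<in> box A B"
      unfolding in_box_complex_iff y by (simp add: A_def B_def)
  qed
  have cboxS: "cbox A B \<subseteq> S"
  proof
    fix y assume "y \<in> cbox A B"
    hence "a / sqrt 2 \<le> Re y" "Re y \<le> b / sqrt 2"
      by (auto simp: in_cbox_complex_iff A_def B_def)
    moreover have "of_int \<lfloor>a\<rfloor> / sqrt 2 < a / sqrt 2" "b / sqrt 2 < of_int \<lceil>b\<rceil> / sqrt 2"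
      using fl by (auto simp: divide_strict_right_mono)
    ultimately show "y \<in> S" by (auto simp: S_def)
  qed
  have pimg: "path_image (rectpath A B) \<subseteq> S - pole ` N"
    using path_image_rectpath_subset_cbox[of A B] path_image_rectpath_inter_box[of A B] ord
      cboxS inbox by blast
  have "contour_integral (rectpath A B) F
      = 2 * pi * \<i> * (\<Sum>p\<in>pole ` N. winding_number (rectpath A B) p * residue F p)"
    using S hol pimg finN cboxS ord
    by (intro Residue_theorem[of S "pole ` N" F])
       (auto intro!: winding_number_rectpath_outside)
  also have "(\<Sum>p\<in>pole ` N. winding_number (rectpath A B) p * residue F p)
      = (\<Sum>p\<in>pole ` N. residue F p)"
    using inbox by (intro sum.cong) (auto simp: winding_number_rectpath)
  also have "\<dots> = (\<Sum>n\<in>N. residue F (pole n))"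
    using inj by (simp add: sum.reindex)
  also have "\<dots> = (\<Sum>n\<in>N. 1 / of_nat n powr s / (2 * of_real pi * \<i>))"
    unfolding F_def pole_def
    by (intro sum.cong refl residue_rot_integrand) (use ab in \<open>auto simp: N_def intro!: gr0I\<close>)
  also have "2 * pi * \<i> * \<dots> = (\<Sum>n\<in>N. 1 / of_nat n powr s)"
    unfolding sum_distrib_left by (intro sum.cong) auto
  finally have *: "contour_integral (rectpath A B) F = (\<Sum>n\<in>N. 1 / of_nat n powr s)" .
  have img: "path_image (rectpath A B) = closed_segment A a2 \<union> (closed_segment a2 B \<union>
      (closed_segment B a4 \<union> closed_segment a4 A))"
    by (simp add: rectpath_def Let_def path_image_join a2_def a4_def)
  have int: "F contour_integrable_on linepath x y"
    if "closed_segment x y \<subseteq> path_image (rectpath A B)" for x y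
    using that pimg hol
    by (intro contour_integrable_continuous_linepath)
       (meson continuous_on_subset holomorphic_on_imp_continuous_on subset_trans)
  \<comment> \<open>The last two are reversed sides: the top and left sides are evaluated in the
    direction of increasing coordinates.\<close>
  have segs: "closed_segment A a2 \<subseteq> path_image (rectpath A B)"
     "closed_segment a2 B \<subseteq> path_image (rectpath A B)"
     "closed_segment B a4 \<subseteq> path_image (rectpath A B)"
     "closed_segment a4 A \<subseteq> path_image (rectpath A B)"
     "closed_segment a4 B \<subseteq> path_image (rectpath A B)"
     "closed_segment A a4 \<subseteq> path_image (rectpath A B)"
    unfolding img closed_segment_commute[of a4 B] closed_segment_commute[of A a4] by blast+
  note ints = segs[THEN int]
  have "contour_integral (rectpath A B) F = contour_integral (linepath A a2) F
      + (contour_integral (linepath a2 B) F + (contour_integral (linepath B a4) F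
      + contour_integral (linepath a4 A) F))"
    unfolding rectpath_def Let_def a2_def[symmetric] a4_def[symmetric]
    using ints by (simp add: contour_integrable_joinI)
  also have "contour_integral (linepath B a4) F = - contour_integral (linepath a4 B) F"
    using ints by (metis contour_integral_reversepath reversepath_linepath valid_path_linepath)
  also have "contour_integral (linepath a4 A) F = - contour_integral (linepath A a4) F"
    using ints by (metis contour_integral_reversepath reversepath_linepath valid_path_linepath)
  also have "contour_integral (linepath A a4) F = \<i> * integral {-T..T} (\<lambda>v. F (Complex (a / sqrt 2) v))"
    using T0 by (intro contour_integral_linepath_same_Re) (auto simp: A_def B_def a4_def)
  also have "contour_integral (linepath a2 B) F = \<i> * integral {-T..T} (\<lambda>v. F (Complex (b / sqrt 2) v))"
    using T0 by (intro contour_integral_linepath_same_Re) (auto simp: A_def B_def a2_def)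
  finally show ?thesis
    using * unfolding N_def A_def B_def a2_def a4_def by simp
qed

text \<open>The sign \<open>k\<close> treats the top and the bottom side together. Their length is
  fixed while the integrand decays like exp(-pi T^2).\<close>

lemma rot_horizontal_tendsto_0:
  assumes ab: "0 < a" "a < b" and s: "Re s \<ge> 0" and k: "\<bar>k\<bar> = (1::real)"
  shows "((\<lambda>T. contour_integral (linepath (Complex (a / sqrt 2) (k * T)) (Complex (b / sqrt 2) (k * T)))
           (rot_integrand s)) \<longlongrightarrow> 0) at_top"
proof (rule Lim_null_comparison)
  define K where "K = exp (\<bar>Re s * ln (a / sqrt 2)\<bar> + \<bar>Im s\<bar> * pi + pi * (b / sqrt 2)\<^sup>2) / 2"
  show "\<forall>\<^sub>F T in at_top. norm (contour_integral
      (linepath (Complex (a / sqrt 2) (k * T)) (Complex (b / sqrt 2) (k * T))) (rot_integrand s))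
      \<le> K * exp (- pi * T\<^sup>2) * (b / sqrt 2 - a / sqrt 2)"
    \<comment> \<open>From this height on |Im y| - Re y \<ge> 1 on the side. The imaginary part of
      the sine's argument is (pi/sqrt 2)(Im y - Re y), so the sine has modulus at least 1.\<close>
    using eventually_ge_at_top[of "b / sqrt 2 + 1"]
  proof eventually_elim
    fix T :: real assume T: "b / sqrt 2 + 1 \<le> T"
    let ?p = "Complex (a / sqrt 2) (k * T)" and ?q = "Complex (b / sqrt 2) (k * T)"
    have b2: "0 < b / sqrt 2" "a / sqrt 2 < b / sqrt 2" "0 < a / sqrt 2"
      using ab by (auto simp: divide_strict_right_mono)
    have seg: "a / sqrt 2 \<le> Re y \<and> Re y \<le> b / sqrt 2 \<and> Im y = k * T"
      if "y \<in> closed_segment ?p ?q" for y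
      using that b2 by (auto simp: closed_segment_same_Im closed_segment_eq_real_ivl)
    have sin1: "1 \<le> cmod (sin (of_real pi * (cis (- (pi / 4)) * y)))"
      if "y \<in> closed_segment ?p ?q" for y
    proof -
      have "1 \<le> \<bar>Im y\<bar> - Re y"
        using seg[OF that] T k b2 by (auto simp: abs_mult)
      also have "\<dots> \<le> \<bar>Im y - Re y\<bar>" using seg[OF that] b2 by linarith
      also have "\<dots> \<le> (pi / sqrt 2) * \<bar>Im y - Re y\<bar>"
      proof -
        have "sqrt 2 \<le> sqrt 4" by (rule real_sqrt_le_mono) simp
        also have "sqrt 4 = (2::real)" by simp
        finally have "1 \<le> pi / sqrt 2" using pi_ge_two by simp
        thus ?thesis using mult_right_mono[of 1 "pi / sqrt 2" "\<bar>Im y - Re y\<bar>"] by simp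
      qed
      also have "\<dots> = \<bar>Im (of_real pi * (cis (- (pi / 4)) * y))\<bar>"
      proof -
        have "Im (of_real pi * (cis (- (pi / 4)) * y)) = (pi / sqrt 2) * (Im y - Re y)"
          by (simp add: cos_45 sin_45 real_div_sqrt field_simps)
        thus ?thesis by (simp add: abs_mult)
      qed
      finally show ?thesis using cmod_sin_ge_Im order_trans by blast
    qed
    have bnd: "cmod (rot_integrand s y) \<le> K * exp (- pi * T\<^sup>2)"
      if "y \<in> closed_segment ?p ?q" for y
    proof -
      have "(Im y)\<^sup>2 = T\<^sup>2" using seg[OF that] k by (metis abs_mult mult_1 power2_abs)
      thus ?thesis
        using rot_integrand_gauss_bound[of s "a / sqrt 2" y "b / sqrt 2" 1] sin1[OF that] seg[OF that] b2 s
        by (simp add: K_def)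
    qed
    have "continuous_on (closed_segment ?p ?q) (rot_integrand s)"
    proof (rule continuous_on_rot_integrand)
      fix y assume y: "y \<in> closed_segment ?p ?q"
      show "Re y > 0" using seg[OF y] b2 by linarith
      show "sin (of_real pi * (cis (- (pi / 4)) * y)) \<noteq> 0" using sin1[OF y] by auto
    qed
    hence "norm (contour_integral (linepath ?p ?q) (rot_integrand s))
        \<le> (K * exp (- pi * T\<^sup>2)) * norm (?q - ?p)"
      using bnd by (intro contour_integral_bound_linepath contour_integrable_continuous_linepath)
         (auto simp: K_def)
    also have "norm (?q - ?p) = b / sqrt 2 - a / sqrt 2"
      using b2 by (simp add: cmod_def)
    finally show "norm (contour_integral (linepath ?p ?q) (rot_integrand s))
        \<le> K * exp (- pi * T\<^sup>2) * (b / sqrt 2 - a / sqrt 2)" .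
  qed
  have "((\<lambda>T::real. exp (- pi * T\<^sup>2)) \<longlongrightarrow> 0) at_top" by real_asymp
  thus "((\<lambda>T. K * exp (- pi * T\<^sup>2) * (b / sqrt 2 - a / sqrt 2)) \<longlongrightarrow> 0) at_top"
    by (intro tendsto_mult_left_zero tendsto_mult_right_zero)
qed

text \<open>Let T tend to infinity. By \<open>RAux_eq_rot\<close> the limits of the right and left
  sides are \<open>- RAux b s\<close> and \<open>RAux a s\<close>.\<close>

lemma RAux_shift:
  assumes ab: "0 < a" "a < b" "a \<notin> \<int>" "b \<notin> \<int>" and s: "Re s \<ge> 0"
  shows "RAux a s - RAux b s = (\<Sum>n | a < real n \<and> real n < b. 1 / of_nat n powr s)"
proof -
  define F where "F = rot_integrand s"
  define H where "H = (\<lambda>k T. contour_integral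
    (linepath (Complex (a / sqrt 2) (k * T)) (Complex (b / sqrt 2) (k * T))) F)"
  define J where "J = (\<lambda>c T. integral {-T..T} (\<lambda>v. F (Complex (c / sqrt 2) v)))"
  define I where "I = (\<lambda>c. LINT v|lborel. F (Complex (c / sqrt 2) v))"
  have J: "(J a \<longlongrightarrow> I a) at_top" "(J b \<longlongrightarrow> I b) at_top"
    unfolding J_def I_def F_def using ab s by (auto intro!: tendsto_integral_rot_line)
  have H: "(H (-1) \<longlongrightarrow> 0) at_top" "(H 1 \<longlongrightarrow> 0) at_top"
    unfolding H_def F_def
    using rot_horizontal_tendsto_0[OF ab(1,2) s, of "-1"] rot_horizontal_tendsto_0[OF ab(1,2) s, of 1]
    by simp_all
  have "((\<lambda>T. H (-1) T + \<i> * J b T - H 1 T - \<i> * J a T) \<longlongrightarrow> 0 + \<i> * I b - 0 - \<i> * I a) at_top"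
    by (intro tendsto_intros J H)
  moreover have "\<forall>\<^sub>F T in at_top. H (-1) T + \<i> * J b T - H 1 T - \<i> * J a T
      = (\<Sum>n | a < real n \<and> real n < b. 1 / of_nat n powr s)"
    using eventually_gt_at_top[of "b / sqrt 2"]
    by eventually_elim (use rot_contour_shift_finite[OF ab, of _ s] in \<open>simp add: H_def J_def F_def\<close>)
  hence "((\<lambda>T. H (-1) T + \<i> * J b T - H 1 T - \<i> * J a T) \<longlongrightarrow>
      (\<Sum>n | a < real n \<and> real n < b. 1 / of_nat n powr s)) at_top"
    by (rule tendsto_eventually)
  ultimately have "0 + \<i> * I b - 0 - \<i> * I a = (\<Sum>n | a < real n \<and> real n < b. 1 / of_nat n powr s)"
    by (intro tendsto_unique) auto
  thus ?thesis
    using ab by (simp add: RAux_eq_rot I_def F_def)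
qed

subsection \<open>Estimates near the saddle point\<close>

text \<open>The first bound says 2 Re \<eta> Re z + 2 Im \<eta> Im z \<ge> -|z|^2. The second
  product is at least -(Im z)^2 - (Im \<eta>)^2, and (Im \<eta>)^2 \<le> (Re \<eta>)^2 is absorbed
  by 2 Re \<eta> Re z \<ge> (3/2) (Re \<eta>)^2.\<close>

lemma saddle_factor_bounds:
  fixes \<eta> z :: complex
  assumes \<eta>: "\<bar>Im \<eta>\<bar> \<le> Re \<eta>" "0 < Re \<eta>" and z: "3 / 4 * Re \<eta> \<le> Re z"
  shows "1 / 2 \<le> Re (1 + \<eta> / z)" "cmod (1 + \<eta> / z) \<le> 3"
proof -
  have z0: "z \<noteq> 0" "0 < Re z" using \<eta> z by auto
  have sq: "(Im \<eta>)\<^sup>2 \<le> (Re \<eta>)\<^sup>2" using \<eta> abs_le_square_iff[of "Im \<eta>" "Re \<eta>"] by simp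
  have "Re \<eta> * (3 / 4 * Re \<eta>) \<le> Re \<eta> * Re z" using z \<eta> by (intro mult_left_mono) auto
  hence "3 / 4 * (Re \<eta>)\<^sup>2 \<le> Re \<eta> * Re z" by (simp add: power2_eq_square)
  moreover have "- ((Im z)\<^sup>2 + (Im \<eta>)\<^sup>2) \<le> 2 * (Im \<eta> * Im z)"
    using sum_squares_bound[of "Im \<eta>" "- Im z"] by simp
  ultimately have "- (Re z)\<^sup>2 - (Im z)\<^sup>2 \<le> 2 * (Re \<eta> * Re z) + 2 * (Im \<eta> * Im z)"
    using sq zero_le_power2[of "Re z"] zero_le_power2[of "Re \<eta>"] by linarith
  moreover have pos: "0 < (Re z)\<^sup>2 + (Im z)\<^sup>2" using z0 by (simp add: sum_power2_gt_zero_iff)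
  ultimately have "- 1 / 2 \<le> Re (\<eta> / z)" by (simp add: Re_divide field_simps)
  thus "1 / 2 \<le> Re (1 + \<eta> / z)" by simp
  have "(cmod \<eta>)\<^sup>2 \<le> 2 * (Re \<eta>)\<^sup>2" using sq by (simp add: cmod_power2)
  also have "\<dots> \<le> 4 * (3 / 4 * Re \<eta>)\<^sup>2" by (simp add: power2_eq_square)
  also have "\<dots> \<le> 4 * (Re z)\<^sup>2" using z \<eta> by (intro mult_left_mono power_mono) auto
  also have "\<dots> \<le> (2 * cmod z)\<^sup>2" by (simp add: cmod_power2)
  finally have "cmod \<eta> \<le> 2 * cmod z" by (rule power2_le_imp_le) simp
  hence "cmod (\<eta> / z) \<le> 2" using z0 by (simp add: norm_divide divide_le_eq)
  thus "cmod (1 + \<eta> / z) \<le> 3" using norm_triangle_ineq[of 1 "\<eta> / z"] by simp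
qed

lemma DERIV_rot_phase:
  assumes "Re y > 0" "s = 2 * of_real pi * \<eta>\<^sup>2"
  shows "(rot_phase s has_field_derivative 2 * of_real pi * ((y - \<eta>) * (1 + \<eta> / y))) (at y)"
proof -
  have y: "y \<notin> \<real>\<^sub>\<le>\<^sub>0" "y \<noteq> 0" using assms by (auto simp: complex_nonpos_Reals_iff)
  have "(rot_phase s has_field_derivative - s * inverse y + of_real pi * (2 * y)) (at y)"
    unfolding rot_phase_def using y by (auto intro!: derivative_eq_intros)
  also have "- s * inverse y + of_real pi * (2 * y) = 2 * of_real pi * ((y - \<eta>) * (1 + \<eta> / y))"
    using y by (simp add: assms(2) field_simps power2_eq_square)
  finally show ?thesis .
qed

text \<open>On the segment from \<eta> to y the real part of the phase has derivative 2 pi \<tau>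
  Re(D^2 q), where D = y - \<eta> and q is the factor of \<open>saddle_factor_bounds\<close>. So
  Re(D^2 q) \<le> B suffices, since 2 pi \<tau> B integrates to pi B.\<close>

lemma rot_phase_saddle_bound:
  assumes \<eta>: "\<bar>Im \<eta>\<bar> \<le> Re \<eta>" "3 / 2 \<le> Re \<eta>" and y: "\<bar>Re y - Re \<eta>\<bar> \<le> 3 / 8"
    and s: "s = 2 * of_real pi * \<eta>\<^sup>2"
  shows "Re (rot_phase s y) \<le> Re (rot_phase s \<eta>) + pi * (6 - (Im y - Im \<eta>)\<^sup>2 / 4)"
proof -
  define D where "D = y - \<eta>"
  define B where "B = 6 - (Im y - Im \<eta>)\<^sup>2 / 4"
  define \<psi> where "\<psi> = (\<lambda>\<tau>::real. Re (rot_phase s (\<eta> + \<tau> *\<^sub>R D)) - pi * \<tau>\<^sup>2 * B)"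
  have "\<psi> 1 \<le> \<psi> 0"
  proof (rule DERIV_nonpos_imp_nonincreasing[where f = \<psi> and a = 0 and b = 1])
    fix \<tau> :: real assume \<tau>: "0 \<le> \<tau>" "\<tau> \<le> 1"
    define z where "z = \<eta> + \<tau> *\<^sub>R D"
    define q where "q = 1 + \<eta> / z"
    have "\<bar>\<tau> * Re D\<bar> \<le> 1 * (3 / 8)"
      unfolding abs_mult using \<tau> y by (intro mult_mono) (auto simp: D_def)
    \<comment> \<open>Re \<eta> \<ge> 3/2 makes 3/8 at most a quarter of Re \<eta>.\<close>
    hence "3 / 4 * Re \<eta> \<le> Re z" using \<eta> unfolding z_def by simp
    hence q: "1 / 2 \<le> Re q" "cmod q \<le> 3" and z: "Re z > 0"
      using saddle_factor_bounds[OF \<eta>(1)] \<eta> unfolding q_def by auto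
    have "((\<lambda>\<tau>. \<eta> + \<tau> *\<^sub>R D) has_vector_derivative D) (at \<tau>)"
      by (auto intro!: derivative_eq_intros)
    moreover have "(rot_phase s has_field_derivative 2 * of_real pi * ((z - \<eta>) * q)) (at (\<eta> + \<tau> *\<^sub>R D))"
      using DERIV_rot_phase[OF z s] unfolding q_def z_def .
    ultimately have "(rot_phase s \<circ> (\<lambda>\<tau>. \<eta> + \<tau> *\<^sub>R D) has_vector_derivative
        D * (2 * of_real pi * ((z - \<eta>) * q))) (at \<tau>)"
      by (rule field_vector_diff_chain_at)
    hence "((\<lambda>\<tau>. rot_phase s (\<eta> + \<tau> *\<^sub>R D)) has_vector_derivative
        D * (2 * of_real pi * ((z - \<eta>) * q))) (at \<tau>)"
      by (simp add: o_def)
    hence "(\<psi> has_field_derivative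
        Re (D * (2 * of_real pi * ((z - \<eta>) * q))) - pi * (2 * \<tau>) * B) (at \<tau>)"
      unfolding \<psi>_def by (auto intro!: derivative_eq_intros)
    also have "D * (2 * of_real pi * ((z - \<eta>) * q)) = of_real (2 * pi * \<tau>) * (D\<^sup>2 * q)"
      by (simp add: z_def power2_eq_square scaleR_conv_of_real)
    also have "Re \<dots> - pi * (2 * \<tau>) * B = (2 * pi * \<tau>) * (Re (D\<^sup>2 * q) - B)"
      by (simp add: algebra_simps)
    finally have der: "(\<psi> has_field_derivative (2 * pi * \<tau>) * (Re (D\<^sup>2 * q) - B)) (at \<tau>)" .
    have "Re (D\<^sup>2 * q) \<le> B"
    proof -
      \<comment> \<open>The three parts of Re(D^2 q) are at most 27/64, -u^2/2 and 9u/4 \<le> u^2/4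
        + 81/16; and 27/64 + 81/16 < 6.\<close>
      define u where "u = \<bar>Im D\<bar>"
      have d: "\<bar>Re D\<bar> \<le> 3 / 8" using y by (simp add: D_def)
      have "Re (D\<^sup>2 * q) = (Re D)\<^sup>2 * Re q - (Im D)\<^sup>2 * Re q - 2 * (Re D * (Im D * Im q))"
        by (simp add: power2_eq_square algebra_simps)
      moreover have "(Re D)\<^sup>2 * Re q \<le> (3 / 8)\<^sup>2 * 3"
      proof (rule mult_mono)
        show "(Re D)\<^sup>2 \<le> (3 / 8)\<^sup>2" using power_mono[OF d, of 2] by simp
        show "Re q \<le> 3" using q complex_Re_le_cmod[of q] by linarith
      qed (use q in auto)
      moreover have "u\<^sup>2 * (1 / 2) \<le> (Im D)\<^sup>2 * Re q"
        unfolding u_def power2_abs using q by (intro mult_left_mono) auto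
      moreover have "\<bar>Re D * (Im D * Im q)\<bar> \<le> (3 / 8) * (u * 3)"
        unfolding abs_mult u_def using d q abs_Im_le_cmod[of q] by (intro mult_mono) auto
      moreover have "(u / 2 - 9 / 4)\<^sup>2 = u\<^sup>2 / 4 - 9 / 4 * u + 81 / 16"
        by (simp add: power2_eq_square algebra_simps)
      hence "9 / 4 * u \<le> u\<^sup>2 / 4 + 81 / 16"
        using zero_le_power2[of "u / 2 - 9 / 4"] by linarith
      moreover have "B = 6 - u\<^sup>2 / 4" by (simp add: B_def D_def u_def)
      moreover have "(3 / 8)\<^sup>2 * 3 = (27 / 64 :: real)" by (simp add: power2_eq_square)
      ultimately show ?thesis by linarith
    qed
    hence "(2 * pi * \<tau>) * (Re (D\<^sup>2 * q) - B) \<le> 0"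
      using \<tau> by (intro mult_nonneg_nonpos) auto
    thus "\<exists>y. (\<psi> has_field_derivative y) (at \<tau>) \<and> y \<le> 0" using der by blast
  qed auto
  thus ?thesis unfolding \<psi>_def B_def D_def by simp
qed

section \<open>The integral along a half-integer line\<close>

definition saddle_const :: real where
  "saddle_const = exp (6 * pi) * (LINT v|lborel. exp (- (pi / 4) * v\<^sup>2))"

text \<open>At a half-integer |sin(pi b)| = 1, so the kernel is at most 1 by
  \<open>cmod_sin_diagonal_ge\<close>. What remains is a Gaussian centred at Im \<eta>, whose
  integral does not depend on its centre.\<close>

lemma RAux_half_integer_bound:
  assumes \<eta>: "\<bar>Im \<eta>\<bar> \<le> Re \<eta>" "3 / 2 \<le> Re \<eta>"
    and s: "s = 2 * of_real pi * \<eta>\<^sup>2" "0 \<le> Re s"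
    and b: "b = of_int k + 1 / 2" "0 < b" "\<bar>b / sqrt 2 - Re \<eta>\<bar> \<le> 3 / 8"
  shows "cmod (RAux b s) \<le> saddle_const * exp (Re (rot_phase s \<eta>))"
proof -
  let ?F = "\<lambda>v. rot_integrand s (Complex (b / sqrt 2) v)"
  define G where "G = (\<lambda>v. exp (6 * pi) * exp (Re (rot_phase s \<eta>)) * exp (- (pi / 4) * (v - Im \<eta>)\<^sup>2))"
  \<comment> \<open>\<open>2 * b\<close> is an odd integer.\<close>
  have "2 * b \<noteq> 2 * of_int m" for m :: int
  proof
    assume "2 * b = 2 * of_int m"
    hence "real_of_int (2 * k + 1) = real_of_int (2 * m)" using b(1) by simp
    hence "2 * k + 1 = 2 * m" by (simp only: of_int_eq_iff)
    thus False by presburger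
  qed
  hence bint: "b \<notin> \<int>" by (auto elim!: Ints_cases)
  have "pi * b = of_int k * pi + pi / 2" by (simp add: b(1) algebra_simps)
  hence "sin (pi * b) = cos (of_int k * pi)" by (simp add: sin_add)
  moreover have "sin (of_int k * pi) = 0" using sin_zero_iff_int2 by blast
  hence "(cos (of_int k * pi))\<^sup>2 = 1" using sin_cos_squared_add[of "of_int k * pi"] by simp
  ultimately have sin1: "\<bar>sin (pi * b)\<bar> = 1" by (auto simp: power2_eq_1_iff)
  have intG: "integrable lborel G"
    unfolding G_def using integrable_gauss[of "pi / 4" "Im \<eta>"] by (intro integrable_mult_right) auto
  have le: "cmod (?F v) \<le> G v" for v
  proof -
    let ?z = "Complex (b / sqrt 2) v"
    have "1 \<le> 2 * cmod (sin (of_real pi * (cis (- (pi / 4)) * ?z)))"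
      using cmod_sin_diagonal_ge[of b v] sin1 by simp
    hence "cmod (?F v) \<le> exp (Re (rot_phase s ?z)) / 1"
      unfolding cmod_rot_integrand by (intro frac_le) auto
    also have "\<dots> \<le> exp (Re (rot_phase s \<eta>) + pi * (6 - (v - Im \<eta>)\<^sup>2 / 4))"
      using rot_phase_saddle_bound[OF \<eta>, of ?z s] b s by simp
    also have "Re (rot_phase s \<eta>) + pi * (6 - (v - Im \<eta>)\<^sup>2 / 4)
        = 6 * pi + Re (rot_phase s \<eta>) + - (pi / 4) * (v - Im \<eta>)\<^sup>2"
      by (simp add: algebra_simps)
    finally show ?thesis unfolding G_def exp_add by simp
  qed
  have "cmod (RAux b s) = cmod (LINT v|lborel. ?F v)"
    using b by (simp add: RAux_eq_rot norm_mult)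
  also have "\<dots> \<le> (LINT v|lborel. cmod (?F v))"
    by (rule integral_norm_bound)
  also have "\<dots> \<le> (LINT v|lborel. G v)"
    using integrable_rot_line[OF b(2) bint s(2)] intG le by (intro integral_mono integrable_norm)
  also have "\<dots> = saddle_const * exp (Re (rot_phase s \<eta>))"
    unfolding G_def saddle_const_def using LINT_gauss_shift[of "pi / 4" "Im \<eta>"] by simp
  finally show ?thesis .
qed

subsection \<open>The function phi\<close>

lemma two_le_exp_1: "(2::real) \<le> exp 1"
  using exp_ge_add_one_self[of "1::real"] by simp

text \<open>
  For \<open>w = r e\<^sup>i\<^sup>(\<^sup>\<alpha>\<^sup>-\<^sup>\<pi>\<^sup>/\<^sup>2\<^sup>)\<close> this is, up to the positive factor \<open>\<pi> r\<^sup>2\<close>, the logarithm of the modulus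
  in the definition of \<open>\<phi>\<close>, so that \<open>\<phi>(r)\<close> is its zero.
\<close>

definition phi_exponent :: "real \<Rightarrow> real \<Rightarrow> real" where
  "phi_exponent r \<alpha> = - 2 * sin (2 * \<alpha>) * (ln r - 1 / 2) + 2 * cos (2 * \<alpha>) * (pi / 2 - \<alpha>) + sin \<alpha> / r"

text \<open>Here w^2 = -r^2 e^(2 i \<alpha>) and log w = ln r + i (\<alpha> - pi/2). The term pi w
  contributes pi r sin \<alpha>, which is the source of sin \<alpha> / r.\<close>

lemma Re_exponent_conv_phi_exponent:
  fixes \<alpha> r :: real
  defines "w \<equiv> of_real r * cis (\<alpha> - pi / 2)"
  assumes r: "r > 0" and \<alpha>: "0 \<le> \<alpha>" "\<alpha> \<le> pi / 4"
  shows "Re (- (2 * of_real pi * \<i> * w\<^sup>2) * Ln w + (of_real pi * \<i> * w\<^sup>2 + of_real pi * w))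
    = pi * r\<^sup>2 * phi_exponent r \<alpha>"
proof -
  have Ln: "Ln w = of_real (ln r) + \<i> * of_real (\<alpha> - pi / 2)"
  proof (rule Ln_unique)
    show "exp (of_real (ln r) + \<i> * of_real (\<alpha> - pi / 2)) = w"
      using r by (simp add: w_def exp_add cis_conv_exp exp_of_real del: of_real_diff)
    show "- pi < Im (of_real (ln r) + \<i> * of_real (\<alpha> - pi / 2))"
      using \<alpha> pi_gt_zero by (simp del: pi_gt_zero)
    show "Im (of_real (ln r) + \<i> * of_real (\<alpha> - pi / 2)) \<le> pi"
      using \<alpha> pi_gt_zero by (simp del: pi_gt_zero)
  qed
  have "w\<^sup>2 = of_real (r\<^sup>2) * cis ((\<alpha> - pi / 2) + (\<alpha> - pi / 2))"
    unfolding w_def power_mult_distrib by (simp only: power2_eq_square cis_mult of_real_mult)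
  also have "(\<alpha> - pi / 2) + (\<alpha> - pi / 2) = 2 * \<alpha> - pi" by simp
  also have "cis (2 * \<alpha> - pi) = - cis (2 * \<alpha>)" by (simp add: complex_eq_iff cos_diff sin_diff)
  finally have w2: "w\<^sup>2 = - (of_real (r\<^sup>2) * cis (2 * \<alpha>))" by simp
  have Rew: "Re w = r * sin \<alpha>" by (simp add: w_def cos_diff)
  have "Re (- (2 * of_real pi * \<i> * w\<^sup>2) * Ln w + (of_real pi * \<i> * w\<^sup>2 + of_real pi * w))
      = 2 * pi * r\<^sup>2 * (- (sin (2 * \<alpha>) * ln r) - cos (2 * \<alpha>) * (\<alpha> - pi / 2))
        + (pi * r\<^sup>2 * sin (2 * \<alpha>) + pi * (r * sin \<alpha>))"
    unfolding w2 Ln using Rew by (simp add: algebra_simps)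
  also have "\<dots> = pi * r\<^sup>2 * phi_exponent r \<alpha>"
    using r by (simp add: phi_exponent_def field_simps power2_eq_square)
  finally show ?thesis .
qed

lemma phi_exponent_deriv:
  "(phi_exponent r has_real_derivative
    (- 4 * cos (2 * \<alpha>) * ln r - 4 * sin (2 * \<alpha>) * (pi / 2 - \<alpha>) + cos \<alpha> / r)) (at \<alpha>)"
proof -
  \<comment> \<open>The contributions 2 cos(2 \<alpha>) and -2 cos(2 \<alpha>) of the first two
    terms cancel.\<close>
  have D: "((\<lambda>\<alpha>. (1 - 2 * ln r) * sin (2 * \<alpha>) + (pi - 2 * \<alpha>) * cos (2 * \<alpha>) + sin \<alpha> * (1 / r))
    has_real_derivative (1 - 2 * ln r) * (cos (2 * \<alpha>) * 2)
      + ((pi - 2 * \<alpha>) * (- sin (2 * \<alpha>) * 2) + (- 2) * cos (2 * \<alpha>)) + cos \<alpha> * (1 / r)) (at \<alpha>)"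
    by (rule derivative_eq_intros refl | simp)+
  have f: "(\<lambda>\<alpha>. (1 - 2 * ln r) * sin (2 * \<alpha>) + (pi - 2 * \<alpha>) * cos (2 * \<alpha>) + sin \<alpha> * (1 / r))
      = phi_exponent r"
    by (rule ext) (simp add: phi_exponent_def algebra_simps)
  have d: "(1 - 2 * ln r) * (cos (2 * \<alpha>) * 2) + ((pi - 2 * \<alpha>) * (- sin (2 * \<alpha>) * 2)
      + (- 2) * cos (2 * \<alpha>)) + cos \<alpha> * (1 / r)
      = - 4 * cos (2 * \<alpha>) * ln r - 4 * sin (2 * \<alpha>) * (pi / 2 - \<alpha>) + cos \<alpha> / r"
    by (simp add: algebra_simps)
  show ?thesis using D unfolding f d .
qed

lemma cos_plus_sin_ge_1:
  assumes "0 \<le> x" "x \<le> pi / 2"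
  shows "1 \<le> cos x + sin x"
proof -
  have "0 \<le> cos x" "0 \<le> sin x" using assms by (auto intro!: cos_ge_zero sin_ge_zero)
  moreover from this have "(cos x)\<^sup>2 \<le> cos x" "(sin x)\<^sup>2 \<le> sin x"
    by (simp_all add: power2_eq_square mult_left_le)
  ultimately show ?thesis using sin_cos_squared_add[of x] by linarith
qed

text \<open>With ln r \<ge> 1, pi/2 - x \<ge> 1/2 and r \<ge> 2 the derivative is at most -4 cos(2x)
  - 2 sin(2x) + 1/2, negative because cos + sin \<ge> 1 on the first quadrant.\<close>

lemma phi_exponent_strict_decreasing:
  assumes r: "exp 1 \<le> r" and \<alpha>: "0 \<le> \<alpha>" "\<alpha> < \<beta>" "\<beta> \<le> pi / 4"
  shows "phi_exponent r \<beta> < phi_exponent r \<alpha>"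
proof (rule DERIV_neg_imp_decreasing[where f = "phi_exponent r" and a = \<alpha> and b = \<beta>])
  have r0: "r > 0" "r \<ge> 2" using r two_le_exp_1 by linarith+
  have lnr: "1 \<le> ln r" using r r0 by (simp add: ln_ge_iff)
  fix x assume x: "\<alpha> \<le> x" "x \<le> \<beta>"
  have x': "0 \<le> 2 * x" "2 * x \<le> pi / 2" "0 \<le> x" "x \<le> pi / 4" using x \<alpha> by auto
  have cs: "0 \<le> cos (2 * x)" "0 \<le> sin (2 * x)" using x' by (auto intro!: cos_ge_zero sin_ge_zero)
  have "cos (2 * x) * 1 \<le> cos (2 * x) * ln r" using cs lnr by (intro mult_left_mono)
  moreover have "sin (2 * x) * (1 / 2) \<le> sin (2 * x) * (pi / 2 - x)"
    using cs x' pi_ge_two by (intro mult_left_mono) auto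
  moreover have "cos x / r \<le> 1 / 2" using r0 cos_le_one[of x] by (intro frac_le) auto
  moreover have "1 \<le> cos (2 * x) + sin (2 * x)" using x' by (intro cos_plus_sin_ge_1)
  ultimately have "- 4 * cos (2 * x) * ln r - 4 * sin (2 * x) * (pi / 2 - x) + cos x / r < 0"
    using cs by linarith
  thus "\<exists>y. (phi_exponent r has_real_derivative y) (at x) \<and> y < 0"
    using phi_exponent_deriv by blast
qed (use \<alpha> in auto)

text \<open>The value at 0 is pi and the value at pi/4 is at most 1 - 2 + 1/2. So there is a zero in
  between, and strict decrease makes it the threshold.\<close>

lemma phi_exponent_threshold:
  assumes r: "exp 1 \<le> r"
  shows "\<exists>f\<in>{0..pi / 4}. \<forall>\<alpha>\<in>{0..pi / 4}. phi_exponent r \<alpha> \<le> 0 \<longleftrightarrow> f \<le> \<alpha>"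
proof -
  have r0: "r > 0" "r \<ge> 2" using r two_le_exp_1 by linarith+
  have lnr: "1 \<le> ln r" using r r0 by (simp add: ln_ge_iff)
  have "phi_exponent r 0 > 0" by (simp add: phi_exponent_def)
  moreover have "phi_exponent r (pi / 4) \<le> 0"
  proof -
    define q where "q = sin (pi / 4) / r"
    have "q \<le> 1 / 2" unfolding q_def using r0 sin_le_one[of "pi / 4"] by (intro frac_le) auto
    moreover have "phi_exponent r (pi / 4) = 1 - 2 * ln r + q"
      by (simp add: phi_exponent_def q_def)
    ultimately show ?thesis using lnr by linarith
  qed
  moreover have "isCont (phi_exponent r) \<alpha>" for \<alpha>
    using phi_exponent_deriv DERIV_isCont by blast
  ultimately obtain f where f: "0 \<le> f" "f \<le> pi / 4" "phi_exponent r f = 0"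
    using IVT2[of "phi_exponent r" "pi / 4" 0 0] by auto
  show ?thesis
  proof (intro bexI ballI)
    fix \<alpha> assume "\<alpha> \<in> {0..pi / 4}"
    thus "phi_exponent r \<alpha> \<le> 0 \<longleftrightarrow> f \<le> \<alpha>"
      using phi_exponent_strict_decreasing[OF r, of \<alpha> f] phi_exponent_strict_decreasing[OF r, of f \<alpha>] f
      by (cases \<alpha> f rule: linorder_cases) auto
  qed (use f in auto)
qed

section \<open>Existence and uniqueness of the threshold function\<close>

definition phi_region :: "complex set" where
  "phi_region = {w. cmod w \<ge> exp 1 \<and>
     cmod (w powr (- (2 * pi * \<i> * w\<^sup>2)) * exp (pi * \<i> * w\<^sup>2 + pi * w)) \<le> 1 \<and>
     - (pi / 2) \<le> Arg w \<and> Arg w \<le> - (pi / 4)}"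

text \<open>The predicate under the description operator that defines \<open>phi\<close>, so that
  unique existence transfers directly.\<close>

definition phi_property :: "(real \<Rightarrow> real) \<Rightarrow> bool" where
  "phi_property f \<longleftrightarrow> f \<in> {exp 1..} \<rightarrow>\<^sub>E {0..pi / 4} \<and>
     phi_region = {w. cmod w \<ge> exp 1 \<and> - (pi / 2) + f (cmod w) \<le> Arg w \<and> Arg w \<le> - (pi / 4)}"

lemma cmod_powr_exp_le_1_iff:
  fixes w :: complex
  assumes "w \<noteq> 0"
  shows "cmod (w powr (- (2 * pi * \<i> * w\<^sup>2)) * exp (pi * \<i> * w\<^sup>2 + pi * w)) \<le> 1
    \<longleftrightarrow> Re (- (2 * of_real pi * \<i> * w\<^sup>2) * Ln w + (of_real pi * \<i> * w\<^sup>2 + of_real pi * w)) \<le> 0"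
proof -
  have "w powr (- (2 * pi * \<i> * w\<^sup>2)) * exp (pi * \<i> * w\<^sup>2 + pi * w)
      = exp (- (2 * of_real pi * \<i> * w\<^sup>2) * Ln w + (of_real pi * \<i> * w\<^sup>2 + of_real pi * w))"
    using assms by (simp only: powr_def if_False exp_add[symmetric] of_real_mult of_real_numeral)
  thus ?thesis by (simp only: norm_exp_eq_Re exp_le_one_iff)
qed

text \<open>Uses the angle \<alpha> = Arg w + pi/2 from the negative imaginary axis and drops the
  positive factor pi |w|^2.\<close>

lemma mem_phi_region_iff:
  "w \<in> phi_region \<longleftrightarrow> cmod w \<ge> exp 1 \<and> - (pi / 2) \<le> Arg w \<and> Arg w \<le> - (pi / 4)
     \<and> phi_exponent (cmod w) (Arg w + pi / 2) \<le> 0"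
proof (cases "cmod w \<ge> exp 1 \<and> - (pi / 2) \<le> Arg w \<and> Arg w \<le> - (pi / 4)")
  case True
  have r0: "cmod w > 0" using True exp_gt_zero[of "1::real"] by linarith
  hence w0: "w \<noteq> 0" by auto
  have w: "w = of_real (cmod w) * cis ((Arg w + pi / 2) - pi / 2)"
    using rcis_cmod_Arg[of w] by (simp add: rcis_def)
  have "Re (- (2 * of_real pi * \<i> * w\<^sup>2) * Ln w + (of_real pi * \<i> * w\<^sup>2 + of_real pi * w))
      = pi * (cmod w)\<^sup>2 * phi_exponent (cmod w) (Arg w + pi / 2)"
    using Re_exponent_conv_phi_exponent[OF r0, of "Arg w + pi / 2", folded w] True by simp
  moreover have "0 < pi * (cmod w)\<^sup>2" using r0 by simp
  note mult_le_cancel_left_pos[OF this, of "phi_exponent (cmod w) (Arg w + pi / 2)" 0]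
  ultimately have "Re (- (2 * of_real pi * \<i> * w\<^sup>2) * Ln w + (of_real pi * \<i> * w\<^sup>2 + of_real pi * w)) \<le> 0
      \<longleftrightarrow> phi_exponent (cmod w) (Arg w + pi / 2) \<le> 0"
    by (simp only: mult_zero_right)
  thus ?thesis
    unfolding phi_region_def mem_Collect_eq cmod_powr_exp_le_1_iff[OF w0] using True by blast
qed (auto simp: phi_region_def)

lemma Arg_of_real_mult_cis:
  assumes "0 < r" "- pi < t" "t \<le> pi"
  shows "Arg (of_real r * cis t) = t"
  using assms by (intro Arg_unique[of r t]) (auto simp: cis_conv_exp)

lemma phi_property_ex1: "\<exists>!f. phi_property f"
proof (rule ex_ex1I)
  \<comment> \<open>The value \<open>undefined\<close> below e is what the extensional function
    space demands.\<close>
  define f where "f = (\<lambda>r. if exp 1 \<le> r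
     then SOME f. f \<in> {0..pi / 4} \<and> (\<forall>\<alpha>\<in>{0..pi / 4}. phi_exponent r \<alpha> \<le> 0 \<longleftrightarrow> f \<le> \<alpha>)
     else undefined)"
  have f: "f r \<in> {0..pi / 4} \<and> (\<forall>\<alpha>\<in>{0..pi / 4}. phi_exponent r \<alpha> \<le> 0 \<longleftrightarrow> f r \<le> \<alpha>)"
    if "exp 1 \<le> r" for r
  proof -
    have "\<exists>f. f \<in> {0..pi / 4} \<and> (\<forall>\<alpha>\<in>{0..pi / 4}. phi_exponent r \<alpha> \<le> 0 \<longleftrightarrow> f \<le> \<alpha>)"
      using phi_exponent_threshold[OF that] by blast
    from someI_ex[OF this] show ?thesis unfolding f_def if_P[OF that] .
  qed
  have "w \<in> phi_region \<longleftrightarrow>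
      cmod w \<ge> exp 1 \<and> - (pi / 2) + f (cmod w) \<le> Arg w \<and> Arg w \<le> - (pi / 4)" for w
  proof (cases "cmod w \<ge> exp 1 \<and> - (pi / 2) \<le> Arg w \<and> Arg w \<le> - (pi / 4)")
    case True
    thus ?thesis using f[of "cmod w"] unfolding mem_phi_region_iff by auto
  next
    case False
    thus ?thesis using f[of "cmod w"] unfolding mem_phi_region_iff by auto
  qed
  moreover have "f r = undefined" if "\<not> exp 1 \<le> r" for r
    unfolding f_def using that by simp
  hence "f \<in> {exp 1..} \<rightarrow>\<^sub>E {0..pi / 4}"
    using f by (intro PiE_I) auto
  ultimately have "phi_property f" unfolding phi_property_def by blast
  thus "\<exists>f. phi_property f" by blast
next
  fix f g assume fg: "phi_property f" "phi_property g"
  \<comment> \<open>The point of modulus r and argument -pi/2 + g'(r) is in the region, hence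
    satisfies the inequality for f' as well. Exchanging the two functions gives equality.\<close>
  have le: "f' r \<le> g' r" if *: "phi_property f'" "phi_property g'" and r: "exp 1 \<le> r" for f' g' r
  proof -
    have r0: "r > 0" using r exp_gt_zero[of "1::real"] by linarith
    have g: "0 \<le> g' r" "g' r \<le> pi / 4"
      using *(2) r by (auto simp: phi_property_def PiE_def Pi_def)
    let ?w = "of_real r * cis (- (pi / 2) + g' r)"
    have A: "Arg ?w = - (pi / 2) + g' r" "cmod ?w = r"
    proof -
      have "- pi < - (pi / 2) + g' r" "- (pi / 2) + g' r \<le> pi"
        using g pi_gt_zero by linarith+
      with r0 show "Arg ?w = - (pi / 2) + g' r" by (rule Arg_of_real_mult_cis)
      show "cmod ?w = r" using r0 by (simp add: norm_mult)
    qed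
    have "?w \<in> phi_region"
      using *(2) A r g unfolding phi_property_def by auto
    hence "- (pi / 2) + f' (cmod ?w) \<le> Arg ?w"
      using *(1) unfolding phi_property_def by blast
    thus ?thesis unfolding A by simp
  qed
  show "f = g"
  proof (rule PiE_ext)
    show "f r = g r" if "r \<in> {exp 1..}" for r
      using le[OF fg] le[OF fg(2,1)] that by (intro antisym) auto
  qed (use fg in \<open>auto simp: phi_property_def\<close>)
qed

lemma phi_property_phi: "phi_property phi"
  unfolding phi_def phi_region_def[symmetric] phi_property_def[symmetric]
  using theI'[OF phi_property_ex1] .

subsection \<open>The remainder\<close>

text \<open>The polar form makes the principal logarithm of the saddle point explicit.\<close>

definition eta :: "complex \<Rightarrow> complex" where
  "eta s = of_real (sqrt (cmod s / (2 * pi))) * cis (Arg s / 2)"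

lemma eta_squared: "s = 2 * of_real pi * (eta s)\<^sup>2"
proof -
  have "(eta s)\<^sup>2 = of_real ((sqrt (cmod s / (2 * pi)))\<^sup>2) * cis (Arg s / 2 + Arg s / 2)"
    unfolding eta_def power_mult_distrib by (simp only: power2_eq_square cis_mult of_real_mult)
  also have "(sqrt (cmod s / (2 * pi)))\<^sup>2 = cmod s / (2 * pi)" by simp
  finally have "2 * of_real pi * (eta s)\<^sup>2 = of_real (cmod s) * cis (Arg s)" by simp
  thus ?thesis using rcis_cmod_Arg[of s] by (simp add: rcis_def)
qed

lemma xi_eq:
  assumes "s \<noteq> 0" "Arg s < pi"
  shows "xi s = cis (- (pi / 4)) * eta s"
    and "xi s = of_real (sqrt (cmod s / (2 * pi))) * cis (Arg s / 2 - pi / 4)"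
proof -
  define w where "w = of_real (sqrt (cmod s / (2 * pi))) * cis (Arg s / 2 - pi / 4)"
  have r: "sqrt (cmod s / (2 * pi)) > 0" using assms by simp
  have w: "w = cis (- (pi / 4)) * eta s"
    by (simp add: w_def eta_def cis_mult)
  have th: "- pi < Arg s" using Arg_bounded by auto
  have Argw: "Arg w = Arg s / 2 - pi / 4"
    unfolding w_def using r th assms by (intro Arg_of_real_mult_cis) auto
  have "(cis (- (pi / 4)))\<^sup>2 = cis (- (pi / 4) + - (pi / 4))"
    by (simp only: power2_eq_square cis_mult)
  also have "\<dots> = - \<i>" by (simp add: complex_eq_iff)
  finally have "w\<^sup>2 = - \<i> * (eta s)\<^sup>2" unfolding w power_mult_distrib by simp
  also have "\<dots> = s / (2 * pi * \<i>)"
    by (subst (2) eta_squared) (simp add: field_simps)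
  finally have w2: "w\<^sup>2 = s / (2 * pi * \<i>)" .
  have "xi s = w"
    unfolding xi_def
  proof (rule the_equality)
    show "w\<^sup>2 = s / (2 * pi * \<i>) \<and> - (3 * pi / 4) < Arg w \<and> Arg w < pi / 4"
      using w2 th assms by (simp add: Argw)
  next
    fix v assume v: "v\<^sup>2 = s / (2 * pi * \<i>) \<and> - (3 * pi / 4) < Arg v \<and> Arg v < pi / 4"
    hence "v = w \<or> v = - w" using w2 by (metis power2_eq_iff)
    \<comment> \<open>The window for Arg is open of length pi, so it cannot contain the arguments of
      both roots.\<close>
    moreover have "v \<noteq> - w"
    proof
      assume "v = - w"
      moreover have "w \<noteq> 0" using r by (auto simp: w_def)
      ultimately show False
        using v Argw th assms by (auto simp: Arg_minus split: if_splits)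
    qed
    ultimately show "v = w" by blast
  qed
  thus "xi s = cis (- (pi / 4)) * eta s"
    and "xi s = of_real (sqrt (cmod s / (2 * pi))) * cis (Arg s / 2 - pi / 4)"
    using w by (simp_all add: w_def)
qed

text \<open>The vertical line through the saddle point crosses the original real axis at
  \<open>sqrt 2 * Re (eta s)\<close>, so \<ell> counts the poles up to that line.\<close>

lemma ell_eq:
  assumes "s \<noteq> 0" "Arg s < pi"
  shows "ell s = \<lfloor>sqrt 2 * Re (eta s)\<rfloor>"
proof -
  have "Re (xi s) - Im (xi s) = sqrt 2 * Re (eta s)"
    unfolding xi_eq(1)[OF assms] by (simp add: cos_45 sin_45 field_simps)
  thus ?thesis by (simp add: ell_def)
qed

lemma Re_rot_phase_eta:
  assumes "s \<noteq> 0"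
  defines "r \<equiv> sqrt (cmod s / (2 * pi))"
  shows "Re (rot_phase s (eta s)) = - Re s * ln r + Re s / 2 + Im s * (Arg s / 2 - pi / 4)"
proof -
  have r: "r > 0" using assms by simp
  have Ln: "Ln (eta s) = of_real (ln r) + \<i> * of_real (Arg s / 2)"
  proof (rule Ln_unique)
    show "exp (of_real (ln r) + \<i> * of_real (Arg s / 2)) = eta s"
      using r by (simp add: eta_def r_def exp_add cis_conv_exp exp_of_real)
    show "- pi < Im (of_real (ln r) + \<i> * of_real (Arg s / 2))"
      and "Im (of_real (ln r) + \<i> * of_real (Arg s / 2)) \<le> pi"
      using Arg_bounded[of s] by auto
  qed
  have sq: "of_real pi * (eta s)\<^sup>2 = s / 2" by (subst (2) eta_squared) simp
  show ?thesis
    unfolding rot_phase_def Ln sq by (simp add: algebra_simps)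
qed

text \<open>Halving the argument gives at most pi/4. The modulus exceeds e \<ge> 5/2 and the cosine
  is at least 7/10, so the real part is at least 7/4.\<close>

lemma eta_sector:
  assumes "cmod s > 2 * pi * (exp 1)\<^sup>2" "\<bar>Arg s\<bar> < pi / 2"
  shows "\<bar>Im (eta s)\<bar> \<le> Re (eta s)" "3 / 2 \<le> Re (eta s)" "exp 1 < sqrt (cmod s / (2 * pi))"
proof -
  define r where "r = sqrt (cmod s / (2 * pi))"
  define x where "x = \<bar>Arg s / 2\<bar>"
  have x: "0 \<le> x" "x \<le> pi / 4" using assms by (auto simp: x_def)
  have "(exp 1)\<^sup>2 < cmod s / (2 * pi)" using assms by (simp add: field_simps)
  hence er: "exp 1 < r" unfolding r_def by (rule real_less_rsqrt)
  thus "exp 1 < sqrt (cmod s / (2 * pi))" unfolding r_def .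
  have r0: "0 \<le> r" using er exp_gt_zero[of "1::real"] by linarith
  have e: "5 / 2 \<le> exp (1::real)" using exp_lower_Taylor_quadratic[of 1] by simp
  have "cos (pi / 4) \<le> cos x" using x by (intro cos_monotone_0_pi_le) auto
  moreover have "sin x \<le> sin (pi / 4)" using x by (intro sin_monotone_2pi_le) auto
  moreover have "7 / 10 \<le> sqrt 2 / 2"
  proof -
    have "7 / 5 \<le> sqrt (2::real)" by (rule real_le_rsqrt) (simp add: power2_eq_square)
    thus ?thesis by simp
  qed
  ultimately have cs: "sin x \<le> cos x" "7 / 10 \<le> cos x" by (simp_all add: cos_45 sin_45)
  have "cos x = cos (Arg s / 2)" unfolding x_def by (rule cos_abs_real)
  hence re: "Re (eta s) = r * cos x"
    by (simp add: eta_def r_def)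
  have "\<bar>sin (Arg s / 2)\<bar> = sin x"
  proof -
    have "0 \<le> sin x" using x by (intro sin_ge_zero) auto
    thus ?thesis unfolding x_def by (cases "Arg s \<ge> 0") auto
  qed
  hence im: "\<bar>Im (eta s)\<bar> = r * sin x"
    using er exp_gt_zero[of "1::real"] by (simp add: eta_def r_def abs_mult)
  show "\<bar>Im (eta s)\<bar> \<le> Re (eta s)"
    unfolding re im using cs r0 by (intro mult_left_mono)
  have "(5 / 2) * (7 / 10) \<le> r * cos x" using e er cs by (intro mult_mono) auto
  thus "3 / 2 \<le> Re (eta s)" unfolding re by simp
qed

lemma RAux_remainder_bound:
  assumes a: "0 < a" "a < 1" and s: "cmod s > 2 * pi * (exp 1)\<^sup>2" "\<bar>Arg s\<bar> < pi / 2"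
  shows "cmod (RAux a s - (\<Sum>n = 1..ell s. 1 / of_int n powr s))
    \<le> saddle_const * exp (Re (rot_phase s (eta s)))"
proof -
  have "0 \<le> 2 * pi * (exp 1)\<^sup>2" by simp
  hence "0 < cmod s" using s(1) by linarith
  hence s0: "s \<noteq> 0" by simp
  have Argpi: "Arg s < pi" using s(2) pi_gt_zero by linarith
  have "0 < cos (Arg s)" using s(2) by (intro cos_gt_zero_pi) auto
  hence Res: "0 \<le> Re s" using cos_Arg[OF s0] by (auto simp: zero_less_divide_iff)
  \<comment> \<open>This half-integer is within 1/2 of the crossing point of the line through the
    saddle point.\<close>
  define b where "b = of_int (ell s) + (1 / 2 :: real)"
  note \<eta> = eta_sector[OF s]
  have sq2: "4 / 3 \<le> sqrt (2::real)" by (rule real_le_rsqrt) (simp add: power2_eq_square)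
  have "(4 / 3) * (3 / 2) \<le> sqrt 2 * Re (eta s)" using sq2 \<eta> by (intro mult_mono) auto
  hence ell: "2 \<le> ell s" unfolding ell_eq[OF s0 Argpi] by (simp add: le_floor_iff)
  have "\<bar>b - sqrt 2 * Re (eta s)\<bar> \<le> 1 / 2"
    unfolding b_def ell_eq[OF s0 Argpi] by linarith
  \<comment> \<open>Dividing 1/2 by sqrt 2 \<ge> 4/3 yields the 3/8 of the saddle estimate.\<close>
  hence "\<bar>b - sqrt 2 * Re (eta s)\<bar> / sqrt 2 \<le> (1 / 2) / (4 / 3)"
    using sq2 by (intro frac_le) simp_all
  moreover have "b / sqrt 2 - Re (eta s) = (b - sqrt 2 * Re (eta s)) / sqrt 2"
    by (simp add: field_simps)
  ultimately have bd: "\<bar>b / sqrt 2 - Re (eta s)\<bar> \<le> 3 / 8" by (simp add: abs_divide)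
  have aint: "a \<notin> \<int>" using a by (auto elim!: Ints_cases)
  have bint: "b \<notin> \<int>"
  proof
    assume "b \<in> \<int>"
    then obtain m :: int where "b = of_int m" by (auto elim: Ints_cases)
    hence "real_of_int (2 * ell s + 1) = real_of_int (2 * m)" by (simp add: b_def)
    hence "2 * ell s + 1 = 2 * m" by (simp only: of_int_eq_iff)
    thus False by presburger
  qed
  have "{n::nat. a < real n \<and> real n < b} = {n. 1 \<le> int n \<and> int n \<le> ell s}"
    using a by (auto simp: b_def)
  hence "(\<Sum>n | a < real n \<and> real n < b. 1 / of_nat n powr s) = (\<Sum>n | 1 \<le> int n \<and> int n \<le> ell s. 1 / of_nat n powr s)"
    by simp
  also have "\<dots> = (\<Sum>n = 1..ell s. 1 / of_int n powr s)"
    by (rule sum.reindex_bij_witness[of _ nat int]) auto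
  finally have "RAux a s - RAux b s = (\<Sum>n = 1..ell s. 1 / of_int n powr s)"
    using RAux_shift[of a b s] a aint bint Res ell by (simp add: b_def)
  hence "RAux a s - (\<Sum>n = 1..ell s. 1 / of_int n powr s) = RAux b s"
    by (simp add: algebra_simps)
  moreover have "cmod (RAux b s) \<le> saddle_const * exp (Re (rot_phase s (eta s)))"
    using \<eta> bd ell Res
    by (intro RAux_half_integer_bound[where k = "ell s"] eta_squared) (auto simp: b_def)
  ultimately show ?thesis by simp
qed

lemma saddle_const_nonneg: "0 \<le> saddle_const"
  unfolding saddle_const_def by (intro mult_nonneg_nonneg integral_nonneg_AE) auto

section \<open>The saddle value on L\<close>

lemma L_sector:
  assumes "s \<in> L"
  shows "cmod s > 2 * pi * (exp 1)\<^sup>2" "\<bar>Arg s\<bar> < pi / 2"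
proof -
  show s: "cmod s > 2 * pi * (exp 1)\<^sup>2" using assms by (simp add: L_def)
  hence "(exp 1)\<^sup>2 < cmod s / (2 * pi)" by (simp add: field_simps)
  hence "exp 1 < sqrt (cmod s / (2 * pi))" by (rule real_less_rsqrt)
  \<comment> \<open>With \<phi> \<ge> 0 the lower limit for Arg s in \<open>L\<close> is at least
    -pi/2.\<close>
  hence "0 \<le> phi (sqrt (cmod s / (2 * pi)))"
    using phi_property_phi by (auto simp: phi_property_def PiE_def Pi_def)
  thus "\<bar>Arg s\<bar> < pi / 2" using assms by (auto simp: L_def)
qed

text \<open>For t > 0 the term t (arg s / 2 - pi/4) is nonpositive and is dropped; the rest is the
  logarithm of the bound.\<close>

lemma L_saddle_value_upper:
  assumes s: "s \<in> L" "Im s > 0"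
  shows "exp (Re (rot_phase s (eta s))) \<le> cmod (s / (2 * pi * exp 1)) powr (- (Re s / 2))"
proof -
  have s0: "s \<noteq> 0" using s by auto
  have "Im s * (Arg s / 2 - pi / 4) \<le> 0"
    using s L_sector[OF s(1)] by (intro mult_nonneg_nonpos) auto
  hence "Re (rot_phase s (eta s)) \<le> - Re s * ln (sqrt (cmod s / (2 * pi))) + Re s / 2"
    unfolding Re_rot_phase_eta[OF s0] by simp
  also have "\<dots> = - (Re s / 2) * ln (cmod s / (2 * pi) / exp 1)"
    using s0 by (subst ln_div) (auto simp: ln_sqrt algebra_simps)
  finally have "exp (Re (rot_phase s (eta s))) \<le> exp (- (Re s / 2) * ln (cmod s / (2 * pi) / exp 1))"
    by simp
  also have "\<dots> = (cmod s / (2 * pi) / exp 1) powr (- (Re s / 2))"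
    using s0 by (simp add: powr_def)
  also have "cmod s / (2 * pi) / exp 1 = cmod (s / (2 * pi * exp 1))"
    by (simp add: norm_divide norm_mult)
  finally show ?thesis .
qed

text \<open>The hypothesis forces cos(2 \<alpha>) \<le> 2 sin(2 \<alpha>) ln r. Together with 1
  \<le> cos(2 \<alpha>) + sin(2 \<alpha>) and ln r \<ge> 1 this gives 1 \<le> 3 sin(2 \<alpha>) ln r
  \<le> 6 sin \<alpha> ln r.\<close>

lemma sin_ge_if_phi_exponent_nonpos:
  assumes r: "exp 1 \<le> r" and \<alpha>: "0 \<le> \<alpha>" "\<alpha> \<le> pi / 4" and neg: "phi_exponent r \<alpha> \<le> 0"
  shows "1 / (6 * ln r) \<le> sin \<alpha>"
proof -
  have r0: "r > 0" using r exp_gt_zero[of "1::real"] by linarith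
  have lnr: "1 \<le> ln r" using r r0 by (simp add: ln_ge_iff)
  have nn: "0 \<le> sin \<alpha>" "0 \<le> sin (2 * \<alpha>)" "0 \<le> cos (2 * \<alpha>)"
    using \<alpha> by (auto intro!: sin_ge_zero cos_ge_zero)
  have "0 \<le> sin \<alpha> / r" using nn r0 by simp
  moreover have "cos (2 * \<alpha>) * (1 / 2) \<le> cos (2 * \<alpha>) * (pi / 2 - \<alpha>)"
    using nn \<alpha> pi_ge_two by (intro mult_left_mono) auto
  moreover have "phi_exponent r \<alpha> = - 2 * (sin (2 * \<alpha>) * ln r) + sin (2 * \<alpha>)
      + 2 * (cos (2 * \<alpha>) * (pi / 2 - \<alpha>)) + sin \<alpha> / r"
    by (simp add: phi_exponent_def algebra_simps)
  ultimately have "cos (2 * \<alpha>) \<le> 2 * (sin (2 * \<alpha>) * ln r)" using neg nn by linarith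
  moreover have "1 \<le> cos (2 * \<alpha>) + sin (2 * \<alpha>)" using \<alpha> by (intro cos_plus_sin_ge_1) auto
  moreover have "sin (2 * \<alpha>) * 1 \<le> sin (2 * \<alpha>) * ln r" using nn lnr by (intro mult_left_mono)
  ultimately have "1 \<le> 3 * (sin (2 * \<alpha>) * ln r)" by linarith
  moreover have "sin (2 * \<alpha>) * ln r \<le> (2 * sin \<alpha>) * ln r"
    using nn lnr cos_le_one[of \<alpha>] by (intro mult_right_mono) (auto simp: sin_double mult_left_le)
  moreover have "(2 * sin \<alpha>) * ln r = 2 * (sin \<alpha> * ln r)" by simp
  ultimately have "1 \<le> 6 * (sin \<alpha> * ln r)" by linarith
  thus ?thesis using lnr by (simp add: field_simps)
qed

lemma L_saddle_value_lower:
  assumes s: "s \<in> L" "Im s < 0"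
  shows "exp (Re (rot_phase s (eta s)))
    \<le> exp (- (pi / (3 * sqrt (2 * pi))) * (sqrt (cmod s) / ln (cmod s)))"
proof -
  define r where "r = sqrt (cmod s / (2 * pi))"
  define \<alpha> where "\<alpha> = Arg s / 2 + pi / 4"
  have s0: "s \<noteq> 0" using s by auto
  note sec = L_sector[OF s(1)]
  have er: "exp 1 < r" using eta_sector(3)[OF sec] by (simp add: r_def)
  hence r0: "r > 0" using exp_gt_zero[of "1::real"] by linarith
  have lnr: "1 < ln r" using er r0 by (metis exp_less_cancel_iff exp_ln)
  have Argneg: "Arg s < 0" using s(2) Arg_neg_iff by blast
  have w: "xi s = of_real r * cis (Arg s / 2 - pi / 4)"
    using sec(2) pi_gt_zero unfolding r_def by (intro xi_eq(2)[OF s0]) linarith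
  have Argw: "Arg (xi s) = Arg s / 2 - pi / 4"
    unfolding w using r0 sec(2) by (intro Arg_of_real_mult_cis) auto
  have cw: "cmod (xi s) = r" using r0 by (simp add: w norm_mult)
  \<comment> \<open>Halving and subtracting pi/4 gives -pi/2 + \<phi>(r) < Arg \<xi>.\<close>
  have "- (pi / 2) + 2 * phi r < Arg s" using s(1) by (simp add: L_def r_def)
  hence "xi s \<in> phi_region"
    using phi_property_phi er Argneg unfolding phi_property_def by (auto simp: cw Argw)
  hence neg: "phi_exponent r \<alpha> \<le> 0"
    unfolding mem_phi_region_iff cw Argw by (simp add: \<alpha>_def algebra_simps)
  have \<alpha>: "0 \<le> \<alpha>" "\<alpha> \<le> pi / 4" using sec(2) Argneg by (auto simp: \<alpha>_def)
  have cs: "cmod s = 2 * pi * r\<^sup>2" by (simp add: r_def)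
  have th: "Arg s = 2 * \<alpha> - pi / 2" by (simp add: \<alpha>_def)
  have "Re s = cmod s * cos (Arg s)" "Im s = cmod s * sin (Arg s)"
    using cos_Arg[OF s0] sin_Arg[OF s0] s0 by auto
  hence st: "Re s = 2 * pi * r\<^sup>2 * sin (2 * \<alpha>)" "Im s = - (2 * pi * r\<^sup>2 * cos (2 * \<alpha>))"
    unfolding cs th by (simp_all add: cos_diff sin_diff)
  \<comment> \<open>The subtracted term is pi Re \<xi>: the modulus defining \<phi> is the saddle
    value times |e^(pi \<xi>)|.\<close>
  have "Re (rot_phase s (eta s)) = pi * r\<^sup>2 * phi_exponent r \<alpha> - pi * r * sin \<alpha>"
    unfolding Re_rot_phase_eta[OF s0] st r_def[symmetric] th phi_exponent_def
    using r0 by (simp add: field_simps power2_eq_square)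
  also have "\<dots> \<le> 0 - pi * r * sin \<alpha>"
    using neg by (intro diff_right_mono mult_nonneg_nonpos) auto
  also have "pi * r * (1 / (6 * ln r)) \<le> pi * r * sin \<alpha>"
    using sin_ge_if_phi_exponent_nonpos[OF _ \<alpha> neg] er r0 by (intro mult_left_mono) auto
  hence "0 - pi * r * sin \<alpha> \<le> - (pi * r * (1 / (6 * ln r)))" by simp
  \<comment> \<open>Source of c: ln |s| = ln(2 pi) + 2 ln r \<ge> 2 ln r, and r = sqrt |s| / sqrt(2
    pi).\<close>
  also have "\<dots> \<le> - (pi / (3 * sqrt (2 * pi)) * (sqrt (cmod s) / ln (cmod s)))"
  proof -
    have "1 \<le> 2 * pi" using pi_ge_two by simp
    hence "0 \<le> ln (2 * pi)" by simp
    moreover have "ln (cmod s) = ln (2 * pi) + 2 * ln r"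
      unfolding cs using r0 by (simp add: ln_mult ln_realpow)
    ultimately have ln: "2 * ln r \<le> ln (cmod s)" by simp
    hence lns: "0 < ln (cmod s)" using lnr by linarith
    have sq: "sqrt (cmod s) = sqrt (2 * pi) * r" unfolding cs using r0 by (simp add: real_sqrt_mult)
    have "pi / (3 * sqrt (2 * pi)) * (sqrt (cmod s) / ln (cmod s)) = (pi * r / 3) / ln (cmod s)"
      unfolding sq by simp
    also have "\<dots> \<le> (pi * r / 3) / (2 * ln r)"
    proof (rule divide_left_mono)
      show "2 * ln r \<le> ln (cmod s)" by (rule ln)
      show "0 \<le> pi * r / 3" using r0 by simp
      show "0 < ln (cmod s) * (2 * ln r)" by (rule mult_pos_pos) (use lns lnr in linarith)+
    qed
    also have "\<dots> = pi * r * (1 / (6 * ln r))" by simp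
    finally show ?thesis by simp
  qed
  finally show ?thesis by simp
qed

theorem theorem12:
  shows "(\<exists>C :: real. \<forall>a s. 0 < a \<and> a < 1 \<and> s \<in> L \<and> Im s > 0 \<longrightarrow>
            cmod (RAux a s - (\<Sum>n = 1..ell s. 1 / of_int n powr s))
              \<le> C * cmod (s / (2 * pi * exp 1)) powr (- (Re s / 2)))
       \<and> (\<exists>c :: real > 0. \<exists>C :: real. \<forall>a s. 0 < a \<and> a < 1 \<and> s \<in> L \<and> Im s < 0 \<longrightarrow>
            cmod (RAux a s - (\<Sum>n = 1..ell s. 1 / of_int n powr s))
              \<le> C * exp (- c * (sqrt (cmod s) / ln (cmod s))))"
proof (intro conjI exI allI impI)
  \<comment> \<open>The implied constant is \<open>saddle_const\<close> for both signs of t.\<close>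
  fix a :: real and s assume "0 < a \<and> a < 1 \<and> s \<in> L \<and> Im s > 0"
  thus "cmod (RAux a s - (\<Sum>n = 1..ell s. 1 / of_int n powr s))
      \<le> saddle_const * cmod (s / (2 * pi * exp 1)) powr (- (Re s / 2))"
    using RAux_remainder_bound L_sector L_saddle_value_upper saddle_const_nonneg
    by (meson mult_left_mono order_trans)
next
  show "pi / (3 * sqrt (2 * pi)) > 0" by simp
next
  fix a :: real and s assume "0 < a \<and> a < 1 \<and> s \<in> L \<and> Im s < 0"
  thus "cmod (RAux a s - (\<Sum>n = 1..ell s. 1 / of_int n powr s))
      \<le> saddle_const * exp (- (pi / (3 * sqrt (2 * pi))) * (sqrt (cmod s) / ln (cmod s)))"
    using RAux_remainder_bound L_sector L_saddle_value_lower saddle_const_nonneg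
    by (meson mult_left_mono order_trans)
qed

end
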